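(* For any map $\varphi:\mathscr{A}\to\mathscr{B}$ of Poisson $C^\infty$-rings the induced map on spectra $\mathrm{Spec}(\varphi) = (f(\varphi), f(\varphi)_\#):\mathrm{Spec}(\mathscr{B})\to\mathrm{Spec}(\mathscr{A})$ is Poisson; that is, for every open set $U\subset X_{\mathscr{A}}$ the map $f(\varphi)_{\#,U}:\mathscr{O}_{\mathscr{A}}(U)\to\mathscr{O}_{\mathscr{B}}(f(\varphi)^{-1}(U))$ preserves the Poisson brackets.
   Context: A $C^\infty$-ring is a set $\mathscr{A}$ with an operation $f_{\mathscr{A}}:\mathscr{A}^n\to\mathscr{A}$ for each $n\geq 0$ and each $f\in C^\infty(\mathbb{R}^n)$, compatible with composition of smooth functions and sending coordinate functions to projections. It has an underlying commutative unital $\mathbb{R}$-algebra. Maps of $C^\infty$-rings are functions preserving all operations. A Poisson $C^\infty$-ring is a $C^\infty$-ring $\mathscr{A}$ with a Poisson bracket on the underlying $\mathbb{R}$-algebra such that for each $a\in\mathscr{A}$ one has $\{a, f_{\mathscr{A}}(a_1,\ldots,a_n)\} = \sum_{i=1}^n (\partial_i f)_{\mathscr{A}}(a_1,\ldots,a_n)\cdot\{a,a_i\}$ for all $n>0$, $f\in C^\infty(\mathbb{R}^n)$, $a_i\in\mathscr{A}$. A map of Poisson $C^\infty$-rings is a map of $C^\infty$-rings preserving the brackets. Construction of $\mathrm{Spec}(\mathscr{A})=(X_{\mathscr{A}},\mathscr{O}_{\mathscr{A}})$. $X_{\mathscr{A}} = \mathrm{Hom}(\mathscr{A},\mathbb{R})$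 is the set of $C^\infty$-ring maps $\mathscr{A}\to\mathbb{R}$ with the topology having as a basis the sets $\{x\in X_{\mathscr{A}}\mid x(a)\neq 0\}$, $a\in\mathscr{A}$. For $x\in X_{\mathscr{A}}$ let $\pi_x:\mathscr{A}\to\mathscr{A}_x$ be the localization of the $C^\infty$-ring $\mathscr{A}$ at $\{a\in\mathscr{A}\mid x(a)\ne 0\}$ (the universal $C^\infty$-ring map making these elements invertible); it is surjective with kernel $I_x=\{a\in\mathscr{A}\mid \exists\, d\in\mathscr{A},\ x(d)\neq 0,\ ad=0\}$. For $a\in\mathscr{A}$ let $\mathfrak{s}_a(x)=\pi_x(a)$. $\mathscr{O}_{\mathscr{A}}(U)$ is the set of all $s:U\to\bigsqcup_{x\in U}\mathscr{A}_x$ (with $s(x)\in\mathscr{A}_x$) that are locally of the form $\mathfrak{s}_a$, $a\in\mathscr{A}$, with pointwise $C^\infty$-ring operations. If $\mathscr{A}$ is Poisson, each $I_x$ is a Poisson ideal and $\mathscr{O}_{\mathscr{A}}$ is a sheaf of Poisson $C^\infty$-rings with the bracket determined by $\{\mathfrak{s}_a|_U,\mathfrak{s}_b|_U\}=\mathfrak{s}_{\{a,b\}}|_U$. Construction of $\mathrm{Spec}(\varphi)$ for a $C^\infty$-ring map $\varphi:\mathscr{A}\to\mathscr{B}$. The continuous map $f(\varphi):X_{\mathscr{B}}\to X_{\mathscr{A}}$ is $f(\varphi)(x)=x\circ\varphi$. For $x\in X_{\mathscr{B}}$ there is a unique $C^\infty$-ring map $\varphi_x:\mathscr{A}_{x\circ\varphi}\to\mathscr{B}_x$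 with $\varphi_x\circ\pi_{x\circ\varphi}=\pi_x\circ\varphi$. The sheaf map $f(\varphi)_\#:\mathscr{O}_{\mathscr{A}}\to f(\varphi)_*\mathscr{O}_{\mathscr{B}}$ is given by $(f(\varphi)_{\#,U}(s))(x)=\varphi_x(s(f(\varphi)(x)))$; in particular $f(\varphi)_{\#,U}(\mathfrak{s}_a|_U)=\mathfrak{s}_{\varphi(a)}|_{f(\varphi)^{-1}(U)}$. *)

theory Defs
  imports "HOL-Analysis.Analysis" "HOL-Algebra.Ideal"
begin

text \<open>Since the arity \<open>n\<close> has to be quantified over, points of \<open>n\<close>-space, and more generally
  \<open>n\<close>-tuples in a set \<open>S\<close>, are the extensional functions in \<open>{..<n} \<rightarrow>\<^sub>E S\<close>; coordinates are
  numbered from \<open>0\<close>.\<close>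

abbreviation Rn :: "nat \<Rightarrow> (nat \<Rightarrow> real) set"
  where "Rn n \<equiv> {..<n} \<rightarrow>\<^sub>E UNIV"

definition partial :: "nat \<Rightarrow> nat \<Rightarrow> ((nat \<Rightarrow> real) \<Rightarrow> real) \<Rightarrow> (nat \<Rightarrow> real) \<Rightarrow> real"
  where "partial n i f = (\<lambda>x\<in>Rn n. deriv (\<lambda>t. f (x(i := t))) (x i))"

text \<open>\<open>Ck n k f\<close>: the partial derivatives of \<open>f\<close> of order at most \<open>k\<close> exist and are continuous.
  The elements of \<open>Cinf n\<close> are extensional, so that equal functions on \<open>n\<close>-space are equal in HOL.\<close>

primrec Ck :: "nat \<Rightarrow> nat \<Rightarrow> ((nat \<Rightarrow> real) \<Rightarrow> real) \<Rightarrow> bool"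
  where
    "Ck n 0 f \<longleftrightarrow> continuous_map (powertop_real {..<n}) euclideanreal f"
  | "Ck n (Suc k) f \<longleftrightarrow>
       continuous_map (powertop_real {..<n}) euclideanreal f \<and>
       (\<forall>i<n. (\<forall>x\<in>Rn n. (\<lambda>t. f (x(i := t))) field_differentiable (at (x i)))
            \<and> Ck n k (partial n i f))"

definition Cinf :: "nat \<Rightarrow> ((nat \<Rightarrow> real) \<Rightarrow> real) set"
  where "Cinf n = {f \<in> extensional (Rn n). \<forall>k. Ck n k f}"

text \<open>\<open>smooth_op A n f a\<close> is \<open>f\<close> applied to the \<open>n\<close>-tuple \<open>a\<close>; it is only meaningful for \<open>f \<in> Cinf n\<close>
  and \<open>a \<in> {..<n} \<rightarrow>\<^sub>E carrier A\<close>.\<close>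

record 'a cinf_ring = "'a partial_object" +
  smooth_op :: "nat \<Rightarrow> ((nat \<Rightarrow> real) \<Rightarrow> real) \<Rightarrow> (nat \<Rightarrow> 'a) \<Rightarrow> 'a"

locale cinf_ring =
  fixes A :: "('a, 'm) cinf_ring_scheme"
  assumes op_closed:
      "\<And>n f a. \<lbrakk>f \<in> Cinf n; a \<in> {..<n} \<rightarrow>\<^sub>E carrier A\<rbrakk> \<Longrightarrow> smooth_op A n f a \<in> carrier A"
    and op_proj:
      "\<And>n i a. \<lbrakk>i < n; a \<in> {..<n} \<rightarrow>\<^sub>E carrier A\<rbrakk> \<Longrightarrow>
         smooth_op A n (\<lambda>x\<in>Rn n. x i) a = a i"
    and op_comp:
      "\<And>n m h g a. \<lbrakk>h \<in> Cinf m; \<And>j. j < m \<Longrightarrow> g j \<in> Cinf n; a \<in> {..<n} \<rightarrow>\<^sub>E carrier A\<rbrakk> \<Longrightarrow>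
         smooth_op A n (\<lambda>x\<in>Rn n. h (\<lambda>j\<in>{..<m}. g j x)) a =
         smooth_op A m h (\<lambda>j\<in>{..<m}. smooth_op A n (g j) a)"

definition cinf_hom ::
    "('a, 'm) cinf_ring_scheme \<Rightarrow> ('b, 'k) cinf_ring_scheme \<Rightarrow> ('a \<Rightarrow> 'b) set"
  where "cinf_hom A B = {\<phi> \<in> carrier A \<rightarrow> carrier B.
    \<forall>n. \<forall>f\<in>Cinf n. \<forall>a\<in>{..<n} \<rightarrow>\<^sub>E carrier A.
      \<phi> (smooth_op A n f a) = smooth_op B n f (\<lambda>i\<in>{..<n}. \<phi> (a i))}"

definition real_cinf_ring :: "real cinf_ring"
  where "real_cinf_ring = \<lparr>carrier = UNIV, smooth_op = (\<lambda>n f a. f a)\<rparr>"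

text \<open>The underlying commutative real algebra: the polynomial functions among the operations, the
  real constants being operations of arity \<open>0\<close>.\<close>

definition pair :: "'a \<Rightarrow> 'a \<Rightarrow> nat \<Rightarrow> 'a"
  where "pair a b = (\<lambda>i\<in>{..<2}. if i = 0 then a else b)"

definition ring_of :: "('a, 'm) cinf_ring_scheme \<Rightarrow> 'a ring"
  where "ring_of A =
    \<lparr>carrier = carrier A,
     mult = (\<lambda>a b. smooth_op A 2 (\<lambda>x\<in>Rn 2. x 0 * x 1) (pair a b)),
     one = smooth_op A 0 (\<lambda>x\<in>Rn 0. 1) (\<lambda>i\<in>{..<0}. undefined),
     zero = smooth_op A 0 (\<lambda>x\<in>Rn 0. 0) (\<lambda>i\<in>{..<0}. undefined),
     add = (\<lambda>a b. smooth_op A 2 (\<lambda>x\<in>Rn 2. x 0 + x 1) (pair a b))\<rparr>"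

definition real_scale :: "('a, 'm) cinf_ring_scheme \<Rightarrow> real \<Rightarrow> 'a \<Rightarrow> 'a"
  where "real_scale A r a = smooth_op A 1 (\<lambda>x\<in>Rn 1. r * x 0) (\<lambda>i\<in>{..<1}. a)"

record 'a poisson_cinf_ring = "'a cinf_ring" +
  bracket :: "'a \<Rightarrow> 'a \<Rightarrow> 'a"

locale poisson_cinf_ring = cinf_ring A for A :: "('a, 'm) poisson_cinf_ring_scheme" +
  assumes bracket_closed:
      "\<And>a b. \<lbrakk>a \<in> carrier A; b \<in> carrier A\<rbrakk> \<Longrightarrow> bracket A a b \<in> carrier A"
    and bracket_add:
      "\<And>a b c. \<lbrakk>a \<in> carrier A; b \<in> carrier A; c \<in> carrier A\<rbrakk> \<Longrightarrow>
         bracket A (a \<oplus>\<^bsub>ring_of A\<^esub> b) c = bracket A a c \<oplus>\<^bsub>ring_of A\<^esub> bracket A b c"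
    and bracket_scale:
      "\<And>r a b. \<lbrakk>a \<in> carrier A; b \<in> carrier A\<rbrakk> \<Longrightarrow>
         bracket A (real_scale A r a) b = real_scale A r (bracket A a b)"
    and bracket_skew:
      "\<And>a b. \<lbrakk>a \<in> carrier A; b \<in> carrier A\<rbrakk> \<Longrightarrow>
         bracket A a b = \<ominus>\<^bsub>ring_of A\<^esub> bracket A b a"
    and bracket_jacobi:
      "\<And>a b c. \<lbrakk>a \<in> carrier A; b \<in> carrier A; c \<in> carrier A\<rbrakk> \<Longrightarrow>
         bracket A a (bracket A b c) \<oplus>\<^bsub>ring_of A\<^esub> bracket A b (bracket A c a)
           \<oplus>\<^bsub>ring_of A\<^esub> bracket A c (bracket A a b) = \<zero>\<^bsub>ring_of A\<^esub>"
    and bracket_leibniz: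
      "\<And>a b c. \<lbrakk>a \<in> carrier A; b \<in> carrier A; c \<in> carrier A\<rbrakk> \<Longrightarrow>
         bracket A a (b \<otimes>\<^bsub>ring_of A\<^esub> c) =
         bracket A a b \<otimes>\<^bsub>ring_of A\<^esub> c \<oplus>\<^bsub>ring_of A\<^esub> b \<otimes>\<^bsub>ring_of A\<^esub> bracket A a c"
    and bracket_smooth_op:
      "\<And>n f a c. \<lbrakk>n > 0; f \<in> Cinf n; a \<in> {..<n} \<rightarrow>\<^sub>E carrier A; c \<in> carrier A\<rbrakk> \<Longrightarrow>
         bracket A c (smooth_op A n f a) =
         (\<Oplus>\<^bsub>ring_of A\<^esub>i\<in>{..<n}.
            smooth_op A n (partial n i f) a \<otimes>\<^bsub>ring_of A\<^esub> bracket A c (a i))"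

definition poisson_hom ::
    "('a, 'm) poisson_cinf_ring_scheme \<Rightarrow> ('b, 'k) poisson_cinf_ring_scheme \<Rightarrow> ('a \<Rightarrow> 'b) set"
  where "poisson_hom A B = {\<phi> \<in> cinf_hom A B.
    \<forall>a\<in>carrier A. \<forall>b\<in>carrier A. \<phi> (bracket A a b) = bracket B (\<phi> a) (\<phi> b)}"

text \<open>Homomorphisms are only determined on the carrier, so points are taken to be extensional.\<close>

definition points :: "('a, 'm) cinf_ring_scheme \<Rightarrow> ('a \<Rightarrow> real) set"
  where "points A = cinf_hom A real_cinf_ring \<inter> extensional (carrier A)"

definition spec_top :: "('a, 'm) cinf_ring_scheme \<Rightarrow> ('a \<Rightarrow> real) topology"
  where "spec_top A =
    topology (arbitrary union_of (\<lambda>U. \<exists>a\<in>carrier A. U = {x \<in> points A. x a \<noteq> 0}))"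

text \<open>The localization of \<open>A\<close> at \<open>{a. x a \<noteq> 0}\<close> is realised as the quotient of \<open>A\<close> by the ideal
  \<open>point_ideal A x\<close>, with projection \<open>germ A x\<close>.  The theorems \<open>loc_cinf_ring\<close>, \<open>germ_hom\<close>, \<open>germ_Units\<close> and
  \<open>localization_universal\<close> below show that this has the defining universal property.  As for the
  multiplication of \<open>FactRing\<close> in HOL-Algebra, operations on cosets are unions over all
  representatives; \<open>loc_op\<close> and \<open>loc_bracket\<close> show that they do not depend on the representatives.\<close>

definition point_ideal :: "('a, 'm) cinf_ring_scheme \<Rightarrow> ('a \<Rightarrow> real) \<Rightarrow> 'a set"
  where "point_ideal A x =
    {a \<in> carrier A. \<exists>d\<in>carrier A. x d \<noteq> 0 \<and> a \<otimes>\<^bsub>ring_of A\<^esub> d = \<zero>\<^bsub>ring_of A\<^esub>}"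

definition germ :: "('a, 'm) cinf_ring_scheme \<Rightarrow> ('a \<Rightarrow> real) \<Rightarrow> 'a \<Rightarrow> 'a set"
  where "germ A x a = point_ideal A x +>\<^bsub>ring_of A\<^esub> a"

definition localization ::
    "('a, 'm) cinf_ring_scheme \<Rightarrow> ('a \<Rightarrow> real) \<Rightarrow> 'a set cinf_ring"
  where "localization A x =
    \<lparr>carrier = germ A x ` carrier A,
     smooth_op = (\<lambda>n f c. \<Union>a\<in>(\<Pi>\<^sub>E i\<in>{..<n}. c i). germ A x (smooth_op A n f a))\<rparr>"

definition poisson_localization ::
    "('a, 'm) poisson_cinf_ring_scheme \<Rightarrow> ('a \<Rightarrow> real) \<Rightarrow> 'a set poisson_cinf_ring"
  where "poisson_localization A x =
    \<lparr>carrier = carrier (localization A x),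
     smooth_op = smooth_op (localization A x),
     bracket = (\<lambda>c d. \<Union>a\<in>c. \<Union>b\<in>d. germ A x (bracket A a b))\<rparr>"

text \<open>\<open>global_section A U a\<close> is \<open>s\<^sub>a\<close>, the section of germs of \<open>a\<close>, restricted to \<open>U\<close>.\<close>

definition global_section ::
    "('a, 'm) cinf_ring_scheme \<Rightarrow> ('a \<Rightarrow> real) set \<Rightarrow> 'a \<Rightarrow> ('a \<Rightarrow> real) \<Rightarrow> 'a set"
  where "global_section A U a = (\<lambda>x\<in>U. germ A x a)"

definition structure_sheaf ::
    "('a, 'm) cinf_ring_scheme \<Rightarrow> ('a \<Rightarrow> real) set \<Rightarrow> (('a \<Rightarrow> real) \<Rightarrow> 'a set) cinf_ring"
  where "structure_sheaf A U =
    \<lparr>carrier = {s \<in> (\<Pi>\<^sub>E x\<in>U. carrier (localization A x)).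
       \<forall>x\<in>U. \<exists>V a. openin (spec_top A) V \<and> x \<in> V \<and> V \<subseteq> U \<and> a \<in> carrier A \<and>
         (\<forall>y\<in>V. s y = germ A y a)},
     smooth_op = (\<lambda>n f s. \<lambda>x\<in>U. smooth_op (localization A x) n f (\<lambda>i\<in>{..<n}. s i x))\<rparr>"

text \<open>The bracket of sections is taken in the localizations, point by point.  It is the bracket
  determined by its values \<open>{s\<^sub>a, s\<^sub>b} = s\<^bsub>{a, b}\<^esub>\<close> on the sections coming from \<open>A\<close>, see
  \<open>poisson_sheaf_bracket\<close> below, because every section locally comes from \<open>A\<close>.\<close>

definition poisson_sheaf ::
    "('a, 'm) poisson_cinf_ring_scheme \<Rightarrow> ('a \<Rightarrow> real) set \<Rightarrow>
     (('a \<Rightarrow> real) \<Rightarrow> 'a set) poisson_cinf_ring"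
  where "poisson_sheaf A U =
    \<lparr>carrier = carrier (structure_sheaf A U),
     smooth_op = smooth_op (structure_sheaf A U),
     bracket = (\<lambda>s t. \<lambda>x\<in>U. bracket (poisson_localization A x) (s x) (t x))\<rparr>"

definition spec_fun ::
    "('a, 'm) cinf_ring_scheme \<Rightarrow> ('b, 'k) cinf_ring_scheme \<Rightarrow> ('a \<Rightarrow> 'b) \<Rightarrow>
     ('b \<Rightarrow> real) \<Rightarrow> 'a \<Rightarrow> real"
  where "spec_fun A B \<phi> = (\<lambda>x\<in>points B. compose (carrier A) x \<phi>)"

text \<open>Existence and uniqueness of this map is \<open>localization_map_ex1\<close> below.\<close>

definition localization_map ::
    "('a, 'm) cinf_ring_scheme \<Rightarrow> ('b, 'k) cinf_ring_scheme \<Rightarrow> ('a \<Rightarrow> 'b) \<Rightarrow>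
     ('b \<Rightarrow> real) \<Rightarrow> 'a set \<Rightarrow> 'b set"
  where "localization_map A B \<phi> x =
    (let L = localization A (spec_fun A B \<phi> x) in
     THE \<psi>. \<psi> \<in> cinf_hom L (localization B x) \<and> \<psi> \<in> extensional (carrier L) \<and>
       (\<forall>a\<in>carrier A. \<psi> (germ A (spec_fun A B \<phi> x) a) = germ B x (\<phi> a)))"

definition spec_preimage ::
    "('a, 'm) cinf_ring_scheme \<Rightarrow> ('b, 'k) cinf_ring_scheme \<Rightarrow> ('a \<Rightarrow> 'b) \<Rightarrow>
     ('a \<Rightarrow> real) set \<Rightarrow> ('b \<Rightarrow> real) set"
  where "spec_preimage A B \<phi> U = {x \<in> points B. spec_fun A B \<phi> x \<in> U}"

definition sheaf_map ::
    "('a, 'm) cinf_ring_scheme \<Rightarrow> ('b, 'k) cinf_ring_scheme \<Rightarrow> ('a \<Rightarrow> 'b) \<Rightarrow>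
     ('a \<Rightarrow> real) set \<Rightarrow> (('a \<Rightarrow> real) \<Rightarrow> 'a set) \<Rightarrow> ('b \<Rightarrow> real) \<Rightarrow> 'b set"
  where "sheaf_map A B \<phi> U s =
    (\<lambda>x\<in>spec_preimage A B \<phi> U. localization_map A B \<phi> x (s (spec_fun A B \<phi> x)))"

lemma Rn_upd: "x \<in> Rn n \<Longrightarrow> i < n \<Longrightarrow> x(i := t) \<in> Rn n"
  by (auto simp: PiE_def extensional_def)

lemma cont_iff:
  "continuous_map (powertop_real {..<n}) euclideanreal f \<longleftrightarrow>
   continuous_on UNIV (\<lambda>x::nat\<Rightarrow>real. f (restrict x {..<n}))" (is "?L \<longleftrightarrow> ?R")
proof
  have r: "continuous_map euclidean (powertop_real {..<n}) (\<lambda>x::nat\<Rightarrow>real. restrict x {..<n})"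
    by (auto simp: continuous_map_componentwise intro!: continuous_on_product_coordinates)
  assume ?L
  from continuous_map_compose[OF r this] show ?R by (simp add: o_def)
next
  have r: "continuous_map (powertop_real {..<n}) euclidean (\<lambda>x::nat\<Rightarrow>real. x)"
    unfolding euclidean_product_topology[symmetric] continuous_map_componentwise_UNIV
  proof
    fix i show "continuous_map (powertop_real {..<n}) euclideanreal (\<lambda>x. x i)"
    proof (cases "i < n")
      case True then show ?thesis by (auto intro: continuous_map_product_projection)
    next
      case False
      have "continuous_map (powertop_real {..<n}) euclideanreal (\<lambda>x. undefined)" by simp
      then show ?thesis by (rule continuous_map_eq) (use False in \<open>auto simp: PiE_def extensional_def\<close>)
    qed
  qed
  assume ?R
  then have "continuous_map euclidean euclideanreal (\<lambda>x::nat\<Rightarrow>real. f (restrict x {..<n}))" by simp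
  from continuous_map_compose[OF r this]
  show ?L by (rule continuous_map_eq) (auto simp: o_def PiE_restrict)
qed

lemma partial_cong:
  assumes "\<And>x. x \<in> Rn n \<Longrightarrow> f x = g x" "i < n"
  shows "partial n i f = partial n i g"
proof -
  have "(\<lambda>t. f (x(i := t))) = (\<lambda>t. g (x(i := t)))" if "x \<in> Rn n" for x
    by (rule ext) (rule assms(1)[OF Rn_upd[OF that assms(2)]])
  then show ?thesis unfolding partial_def by (intro restrict_ext) simp
qed

lemma Ck_cong:
  assumes "\<And>x. x \<in> Rn n \<Longrightarrow> f x = g x"
  shows "Ck n k f = Ck n k g"
proof -
  have c: "continuous_map (powertop_real {..<n}) euclideanreal f =
        continuous_map (powertop_real {..<n}) euclideanreal g"
    unfolding cont_iff using assms by (simp add: restrict_PiE_iff)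
  have e: "(\<lambda>t. f (x(i := t))) = (\<lambda>t. g (x(i := t)))" if "x \<in> Rn n" "i < n" for x i
    by (rule ext) (rule assms[OF Rn_upd[OF that]])
  have p: "partial n i f = partial n i g" if "i < n" for i
    by (rule partial_cong[OF assms that])
  show ?thesis
  proof (cases k)
    case 0 then show ?thesis using c by simp
  next
    case (Suc l)
    show ?thesis unfolding Suc Ck.simps c using e p by (metis (no_types, lifting))
  qed
qed

lemma Ck_SucI:
  assumes "continuous_map (powertop_real {..<n}) euclideanreal f"
    and D: "\<And>i x. i < n \<Longrightarrow> x \<in> Rn n \<Longrightarrow>
        ((\<lambda>t. f (x(i := t))) has_real_derivative D i x) (at (x i))"
    and "\<And>i. i < n \<Longrightarrow> Ck n k (D i)"
  shows "Ck n (Suc k) f"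
proof -
  have "Ck n k (partial n i f)" if "i < n" for i
  proof -
    have "Ck n k (partial n i f) = Ck n k (D i)"
      by (rule Ck_cong) (simp add: partial_def DERIV_imp_deriv[OF D[OF that]])
    with assms(3)[OF that] show ?thesis by simp
  qed
  then show ?thesis using assms(1) D
    by (auto simp: field_differentiable_def)
qed

lemma Ck_cont: "Ck n k f \<Longrightarrow> continuous_map (powertop_real {..<n}) euclideanreal f"
  by (cases k) auto

lemma Ck_deriv:
  assumes "Ck n (Suc k) f" "i < n" "x \<in> Rn n"
  shows "((\<lambda>t. f (x(i := t))) has_real_derivative partial n i f x) (at (x i))"
proof -
  have "(\<lambda>t. f (x(i := t))) field_differentiable (at (x i))" using assms by auto
  then show ?thesis using assms(3) by (simp add: partial_def field_differentiable_derivI)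
qed

lemma Ck_partial: "Ck n (Suc k) f \<Longrightarrow> i < n \<Longrightarrow> Ck n k (partial n i f)"
  by auto

lemma Ck_deriv_upd:
  assumes "Ck n (Suc k) f" "i < n" "x \<in> Rn n"
  shows "((\<lambda>t. f (x(i := t))) has_real_derivative partial n i f (x(i := u))) (at u)"
  using Ck_deriv[OF assms(1,2) Rn_upd[OF assms(3,2)], of u] by simp

lemma Ck_mono1: "Ck n (Suc k) f \<Longrightarrow> Ck n k f"
proof (induction k arbitrary: f)
  case 0 then show ?case by auto
next
  case (Suc k)
  show ?case
    by (rule Ck_SucI[where D = "\<lambda>i. partial n i f", OF Ck_cont[OF Suc.prems] Ck_deriv[OF Suc.prems]
        Suc.IH[OF Ck_partial[OF Suc.prems]]])
qed

lemma Ck_const: "Ck n k (\<lambda>x. c)"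
proof (induction k arbitrary: c)
  case (Suc k)
  show ?case by (rule Ck_SucI[where D = "\<lambda>i x. 0"]) (use Suc in auto)
qed auto

lemma Ck_proj: "i < n \<Longrightarrow> Ck n k (\<lambda>x. x i)"
proof (induction k)
  case 0 then show ?case by (auto intro: continuous_map_product_projection)
next
  case (Suc k)
  show ?case
  proof (rule Ck_SucI[where D = "\<lambda>j x. if j = i then 1 else 0"])
    show "Ck n k (\<lambda>x. if j = i then 1 else 0)" for j by (rule Ck_const)
  qed (use Suc in \<open>auto intro: continuous_map_product_projection\<close>)
qed

lemma Ck_add: "Ck n k f \<Longrightarrow> Ck n k g \<Longrightarrow> Ck n k (\<lambda>x. f x + g x)"
proof (induction k arbitrary: f g)
  case 0 then show ?case by (auto intro: continuous_map_add)
next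
  case (Suc k)
  show ?case
  proof (rule Ck_SucI[where D = "\<lambda>i x. partial n i f x + partial n i g x"])
    show "continuous_map (powertop_real {..<n}) euclideanreal (\<lambda>x. f x + g x)"
      using Suc.prems by (auto intro: continuous_map_add)
    show "((\<lambda>t. f (x(i := t)) + g (x(i := t))) has_real_derivative partial n i f x + partial n i g x) (at (x i))"
      if "i < n" "x \<in> Rn n" for i x
      using Ck_deriv[OF Suc.prems(1) that] Ck_deriv[OF Suc.prems(2) that] by (rule DERIV_add)
    show "Ck n k (\<lambda>x. partial n i f x + partial n i g x)" if "i < n" for i
      using Suc.prems that by (auto intro: Suc.IH)
  qed
qed

lemma Ck_mult: "Ck n k f \<Longrightarrow> Ck n k g \<Longrightarrow> Ck n k (\<lambda>x. f x * g x)"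
proof (induction k arbitrary: f g)
  case 0 then show ?case by (auto intro: continuous_map_real_mult)
next
  case (Suc k)
  show ?case
  proof (rule Ck_SucI[where D = "\<lambda>i x. partial n i f x * g x + partial n i g x * f x"])
    show "continuous_map (powertop_real {..<n}) euclideanreal (\<lambda>x. f x * g x)"
      using Suc.prems by (auto intro: continuous_map_real_mult)
    show "((\<lambda>t. f (x(i := t)) * g (x(i := t))) has_real_derivative partial n i f x * g x + partial n i g x * f x) (at (x i))"
      if "i < n" "x \<in> Rn n" for i x
    proof -
      have "((\<lambda>t. f (x(i := t)) * g (x(i := t))) has_real_derivative
          partial n i f x * g (x(i := x i)) + partial n i g x * f (x(i := x i))) (at (x i))"
        by (rule DERIV_mult[OF Ck_deriv[OF Suc.prems(1) that] Ck_deriv[OF Suc.prems(2) that]])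
      then show ?thesis by simp
    qed
    show "Ck n k (\<lambda>x. partial n i f x * g x + partial n i g x * f x)" if "i < n" for i
      by (intro Ck_add Suc.IH Ck_partial[OF Suc.prems(1) that] Ck_partial[OF Suc.prems(2) that]
           Ck_mono1[OF Suc.prems(1)] Ck_mono1[OF Suc.prems(2)])
  qed
qed

lemma Ck_inverse: "Ck n k f \<Longrightarrow> (\<And>x. x \<in> Rn n \<Longrightarrow> f x \<noteq> 0) \<Longrightarrow> Ck n k (\<lambda>x. inverse (f x))"
proof (induction k)
  case 0 then show ?case by (auto intro: continuous_map_real_inverse)
next
  case (Suc k)
  have I: "Ck n k (\<lambda>x. inverse (f x))" using Suc Ck_mono1 by blast
  show ?case
  proof (rule Ck_SucI[where D = "\<lambda>i x. (-1) * partial n i f x * inverse (f x) * inverse (f x)"])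
    show "continuous_map (powertop_real {..<n}) euclideanreal (\<lambda>x. inverse (f x))"
      using Suc.prems by (auto intro: continuous_map_real_inverse)
    show "((\<lambda>t. inverse (f (x(i := t)))) has_real_derivative (-1) * partial n i f x * inverse (f x) * inverse (f x)) (at (x i))"
      if "i < n" "x \<in> Rn n" for i x
    proof -
      have "((\<lambda>t. inverse (f (x(i := t)))) has_real_derivative
          - (inverse (f (x(i := x i))) * partial n i f x * inverse (f (x(i := x i))))) (at (x i))"
        by (rule DERIV_inverse'[OF Ck_deriv[OF Suc.prems(1) that]]) (use Suc.prems(2)[OF that(2)] in simp)
      then show ?thesis by (simp add: mult.commute mult.left_commute)
    qed
    show "Ck n k (\<lambda>x. (-1) * partial n i f x * inverse (f x) * inverse (f x))" if "i < n" for i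
      by (intro Ck_mult Ck_const I Ck_partial[OF Suc.prems(1) that])
  qed
qed

definition bump :: "nat \<Rightarrow> real \<Rightarrow> real"
  where "bump m t = (if t > 0 then (1/t) ^ m * exp (- (1/t)) else 0)"

lemma bump_deriv: "(bump m has_real_derivative bump (m+2) t - real m * bump (m+1) t) (at t)"
proof -
  consider "t > 0" | "t < 0" | "t = 0" by linarith
  then show ?thesis
  proof cases
    case 1
    have "((\<lambda>t. (1/t) ^ m * exp (- (1/t))) has_real_derivative bump (m+2) t - real m * bump (m+1) t) (at t)"
    proof -
      have "((\<lambda>t. (\<lambda>u. u ^ m * exp (- u)) (inverse t)) has_real_derivative
          (real m * inverse t ^ (m - 1) * exp (- inverse t) - inverse t ^ m * exp (- inverse t)) * (- (inverse t ^ 2))) (at t)"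
      proof (rule DERIV_chain2[where f = "\<lambda>u. u ^ m * exp (- u)" and g = inverse])
        show "((\<lambda>u. u ^ m * exp (- u)) has_real_derivative
           (real m * inverse t ^ (m - 1) * exp (- inverse t) - inverse t ^ m * exp (- inverse t))) (at (inverse t))"
          by (auto intro!: derivative_eq_intros)
        show "(inverse has_real_derivative - (inverse t ^ 2)) (at t)"
          using DERIV_inverse[of t UNIV] 1 by (simp add: numeral_2_eq_2)
      qed
      moreover have "(real m * u ^ (m - 1) * e - u ^ m * e) * (- (u ^ 2)) =
          u ^ (m + 2) * e - real m * (u ^ (m + 1) * e)" for u e :: real
        by (cases m) (simp_all add: algebra_simps power2_eq_square)
      ultimately show ?thesis using 1 by (simp add: bump_def inverse_eq_divide)
    qed
    moreover have "\<forall>\<^sub>F s in nhds t. bump m s = (1/s) ^ m * exp (- (1/s))"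
      by (rule eventually_mono[OF eventually_nhds_in_open[of "{0<..}" t]]) (use 1 in \<open>auto simp: bump_def\<close>)
    ultimately show ?thesis by (rule DERIV_cong_ev[OF refl _ refl, THEN iffD2, rotated])
  next
    case 2
    have "\<forall>\<^sub>F s in nhds t. bump m s = (\<lambda>_. 0) s"
      by (rule eventually_mono[OF eventually_nhds_in_open[of "{..<0}" t]]) (use 2 in \<open>auto simp: bump_def\<close>)
    then have "(bump m has_real_derivative 0) (at t)"
      by (rule DERIV_cong_ev[OF refl _ refl, THEN iffD2]) simp
    moreover have "bump (m + 2) t - real m * bump (m + 1) t = 0" using 2 by (simp add: bump_def)
    ultimately show ?thesis by simp
  next
    case 3
    have "((\<lambda>h. bump m h / h) \<longlongrightarrow> 0) (at_right 0)"
    proof -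
      have "((\<lambda>h::real. (1/h) ^ m * exp (- (1/h)) / h) \<longlongrightarrow> 0) (at_right 0)"
      proof -
        have "((\<lambda>u::real. u ^ Suc m / exp u) \<longlongrightarrow> 0) at_top"
          by (rule tendsto_power_div_exp_0)
        moreover have "filterlim (\<lambda>h::real. 1/h) at_top (at_right 0)"
          using filterlim_inverse_at_top_right by (simp add: inverse_eq_divide)
        ultimately have "((\<lambda>h::real. (1/h) ^ Suc m / exp (1/h)) \<longlongrightarrow> 0) (at_right 0)"
          by (rule filterlim_compose)
        then show ?thesis by (simp add: exp_minus field_simps)
      qed
      moreover have "\<forall>\<^sub>F h::real in at_right 0. (1/h) ^ m * exp (- (1/h)) / h = bump m h / h"
        by (auto simp: eventually_at_filter bump_def)
      ultimately show ?thesis by (rule Lim_transform_eventually)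
    qed
    moreover have "((\<lambda>h. bump m h / h) \<longlongrightarrow> 0) (at_left 0)"
    proof -
      have "\<forall>\<^sub>F h::real in at_left 0. 0 = bump m h / h"
        by (auto simp: eventually_at_filter bump_def)
      from Lim_transform_eventually[OF tendsto_const this] show ?thesis .
    qed
    ultimately have "((\<lambda>h. bump m h / h) \<longlongrightarrow> 0) (at 0)"
      by (simp add: filterlim_at_split)
    then show ?thesis using 3 by (simp add: DERIV_def bump_def[of _ 0])
  qed
qed

lemma Ck_bump: "Ck 1 k (\<lambda>x. bump m (c * x 0 + b))"
proof (induction k arbitrary: m)
  have cont: "continuous_map (powertop_real {..<1}) euclideanreal (\<lambda>x::nat\<Rightarrow>real. bump m (c * x 0 + b))" for m
  proof -
    have "continuous_on UNIV (bump m)"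
      using bump_deriv by (auto intro!: DERIV_continuous_on)
    from continuous_on_compose2[OF this, of UNIV "\<lambda>x::nat\<Rightarrow>real. c * x 0 + b"]
    show ?thesis unfolding cont_iff
      by (simp add: continuous_intros)
  qed
  {
    case 0 then show ?case using cont by simp
  next
    case (Suc k)
    show ?case
    proof (rule Ck_SucI[where D = "\<lambda>i x. c * (bump (m+2) (c * x 0 + b) + (- real m) * bump (m+1) (c * x 0 + b))"])
      show "Ck 1 k (\<lambda>x. c * (bump (m+2) (c * x 0 + b) + (- real m) * bump (m+1) (c * x 0 + b)))" for i::nat
        by (intro Ck_mult Ck_add Ck_const Suc.IH)
      fix i::nat and x assume "i < 1" "x \<in> Rn 1"
      then have [simp]: "i = 0" by simp
      have "((\<lambda>t. bump m (c * t + b)) has_real_derivative (bump (m+2) (c * x 0 + b) - real m * bump (m+1) (c * x 0 + b)) * c) (at (x 0))"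
        by (rule DERIV_chain2[OF bump_deriv]) (auto intro!: derivative_eq_intros)
      then show "((\<lambda>t. bump m (c * (x(i := t)) 0 + b)) has_real_derivative c * (bump (m+2) (c * x 0 + b) + (- real m) * bump (m+1) (c * x 0 + b))) (at (x i))"
        by (simp add: mult.commute)
    qed (rule cont)
  }
qed

text \<open>\<open>hadamard n i f\<close>, below, is a smooth function on \<open>(n + 1)\<close>-space by which the change of \<open>f\<close> is
  divisible when the single coordinate \<open>x i\<close> is replaced by \<open>x n\<close>.  It gives both the chain rule and
  the fact that every ideal of the underlying ring is compatible with all smooth operations.\<close>

definition mixpt :: "nat \<Rightarrow> nat \<Rightarrow> real \<Rightarrow> (nat \<Rightarrow> real) \<Rightarrow> nat \<Rightarrow> real"
  where "mixpt n i t x = (restrict x {..<n})(i := (1 - t) * x i + t * x n)"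

lemma mixpt_in: "i < n \<Longrightarrow> mixpt n i t x \<in> Rn n"
  by (auto simp: mixpt_def PiE_def extensional_def)

lemma mixpt_upd:
  assumes "i < n"
  shows "j < n \<Longrightarrow> j \<noteq> i \<Longrightarrow> mixpt n i t (x(j := s)) = (mixpt n i t x)(j := s)"
    and "mixpt n i t (x(i := s)) = (mixpt n i t x)(i := (1 - t) * s + t * x n)"
    and "mixpt n i t (x(n := s)) = (mixpt n i t x)(i := (1 - t) * x i + t * s)"
  using assms by (auto simp: mixpt_def fun_eq_iff)

lemma mixpt_at:
  assumes "i < n"
  shows "j < n \<Longrightarrow> j \<noteq> i \<Longrightarrow> mixpt n i t x j = x j"
    and "mixpt n i t x i = (1 - t) * x i + t * x n"
  using assms by (auto simp: mixpt_def)

definition mixw :: "nat \<Rightarrow> nat \<Rightarrow> nat \<Rightarrow> real \<Rightarrow> real"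
  where "mixw n i j t = (if j = n then t else if j = i then 1 - t else 1)"

definition mixj :: "nat \<Rightarrow> nat \<Rightarrow> nat \<Rightarrow> nat"
  where "mixj n i j = (if j = n then i else j)"

lemma mixpt_deriv:
  assumes h: "Ck n (Suc k) h" and "i < n" "j < Suc n"
  shows "((\<lambda>s. h (mixpt n i t (x(j := s)))) has_real_derivative
     mixw n i j t * partial n (mixj n i j) h (mixpt n i t (x(j := u)))) (at u)"
proof -
  consider "j = n" | "j = i" | "j < n" "j \<noteq> i" using assms by linarith
  then show ?thesis
  proof cases
    case 1
    have "((\<lambda>s. h ((mixpt n i t x)(i := (1 - t) * x i + t * s))) has_real_derivative
      partial n i h ((mixpt n i t x)(i := (1 - t) * x i + t * u)) * t) (at u)"
      by (rule DERIV_chain2[OF Ck_deriv_upd[OF h \<open>i < n\<close> mixpt_in[OF \<open>i < n\<close>]]])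
         (auto intro!: derivative_eq_intros)
    then show ?thesis using 1 assms by (simp add: mixpt_upd mixw_def mixj_def mult.commute)
  next
    case 2
    have "((\<lambda>s. h ((mixpt n i t x)(i := (1 - t) * s + t * x n))) has_real_derivative
      partial n i h ((mixpt n i t x)(i := (1 - t) * u + t * x n)) * (1 - t)) (at u)"
      by (rule DERIV_chain2[OF Ck_deriv_upd[OF h \<open>i < n\<close> mixpt_in[OF \<open>i < n\<close>]]])
         (auto intro!: derivative_eq_intros)
    then show ?thesis using 2 assms by (simp add: mixpt_upd mixw_def mixj_def mult.commute)
  next
    case 3
    then show ?thesis using assms Ck_deriv_upd[OF h 3(1) mixpt_in[OF \<open>i < n\<close>]]
      by (simp add: mixpt_upd mixw_def mixj_def)
  qed
qed

lemma mixpt_cont: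
  assumes h: "Ck n k h" and "i < n"
  shows "continuous_on UNIV (\<lambda>(x, t). h (mixpt n i t x))"
proof -
  have "continuous_on UNIV (\<lambda>x. h (restrict x {..<n}))"
    using Ck_cont[OF h] cont_iff by blast
  moreover have "continuous_on UNIV (\<lambda>z. mixpt n i (snd z) (fst z))"
  proof (rule continuous_on_coordinatewise_then_product)
    fix j
    have "continuous_on UNIV (\<lambda>z::(nat\<Rightarrow>real)\<times>real. fst z j)" for j
      by (rule continuous_on_compose2[OF continuous_on_product_coordinates[of j] continuous_on_fst[OF continuous_on_id]]) simp
    note this [continuous_intros]
    show "continuous_on UNIV (\<lambda>z. mixpt n i (snd z) (fst z) j)"
      by (cases "j = i"; cases "j < n") (auto simp: mixpt_def intro!: continuous_intros)
  qed
  ultimately have "continuous_on UNIV (\<lambda>z. h (restrict (mixpt n i (snd z) (fst z)) {..<n}))"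
    by (rule continuous_on_compose2) auto
  moreover have "restrict (mixpt n i t x) {..<n} = mixpt n i t x" for t x
    using mixpt_in[OF \<open>i < n\<close>, of t x] by (rule PiE_restrict)
  ultimately show ?thesis by (simp add: case_prod_unfold)
qed

lemma mixpt_restrict: "i < n \<Longrightarrow> mixpt n i t (restrict x {..<Suc n}) = mixpt n i t x"
  by (auto simp: mixpt_def fun_eq_iff)

lemma Ck_mix:
  assumes "i < n" shows "Ck n k h \<Longrightarrow> Ck (Suc n) k (\<lambda>x. h (mixpt n i t x))"
proof (induction k arbitrary: h)
  have cont: "continuous_map (powertop_real {..<Suc n}) euclideanreal (\<lambda>x. h (mixpt n i t x))"
    if "Ck n k h" for k h
  proof -
    have "continuous_on UNIV (\<lambda>x::nat\<Rightarrow>real. (x, t))" by (intro continuous_intros)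
    from continuous_on_compose2[OF mixpt_cont[OF that assms] this]
    show ?thesis unfolding cont_iff mixpt_restrict[OF assms] by simp
  qed
  {
    case 0 show ?case using cont[OF 0] by simp
  next
    case (Suc k)
    show ?case
    proof (rule Ck_SucI[where D = "\<lambda>j x. mixw n i j t * partial n (mixj n i j) h (mixpt n i t x)"])
      fix j assume j: "j < Suc n"
      then have "mixj n i j < n" using assms by (auto simp: mixj_def)
      then show "Ck (Suc n) k (\<lambda>x. mixw n i j t * partial n (mixj n i j) h (mixpt n i t x))"
        by (intro Ck_mult Ck_const Suc.IH Ck_partial[OF Suc.prems])
      fix x
      show "((\<lambda>s. h (mixpt n i t (x(j := s)))) has_real_derivative
         mixw n i j t * partial n (mixj n i j) h (mixpt n i t x)) (at (x j))"
        using mixpt_deriv[OF Suc.prems assms j, of t x "x j"] by simp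
    qed (rule cont[OF Suc.prems])
  }
qed

lemma Ck_integral:
  assumes "i < n"
  shows "Ck n k h \<Longrightarrow> continuous_on UNIV p \<Longrightarrow>
    Ck (Suc n) k (\<lambda>x. integral {0..1} (\<lambda>t. p t * h (mixpt n i t x)))"
proof (induction k arbitrary: h p)
  have c: "continuous_on UNIV (\<lambda>(x, t). p t * h (mixpt n i t x))"
    if "Ck n k h" "continuous_on UNIV p" for k h p
  proof -
    have "continuous_on UNIV (\<lambda>z::(nat \<Rightarrow> real) \<times> real. p (snd z))"
      by (rule continuous_on_compose2[OF that(2)]) (auto intro!: continuous_intros)
    with mixpt_cont[OF that(1) assms] show ?thesis
      by (auto simp: case_prod_unfold intro!: continuous_intros)
  qed
  have cont: "continuous_map (powertop_real {..<Suc n}) euclideanreal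
      (\<lambda>x. integral {0..1} (\<lambda>t. p t * h (mixpt n i t x)))"
    if "Ck n k h" "continuous_on UNIV p" for k h p
    unfolding cont_iff mixpt_restrict[OF assms] box_real(2)[symmetric]
    by (rule integral_continuous_on_param) (rule continuous_on_subset[OF c[OF that]], simp)
  {
    case 0 show ?case using cont[OF 0] by simp
  next
    case (Suc k)
    let ?D = "\<lambda>j x t. (p t * mixw n i j t) * partial n (mixj n i j) h (mixpt n i t x)"
    show ?case
    proof (rule Ck_SucI[where D = "\<lambda>j x. integral {0..1} (?D j x)"])
      fix j assume j: "j < Suc n"
      then have m: "mixj n i j < n" using assms by (auto simp: mixj_def)
      have w: "continuous_on UNIV (mixw n i j)"
        by (cases "j = n"; cases "j = i") (auto simp: mixw_def[abs_def] intro!: continuous_intros)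
      have pw: "continuous_on UNIV (\<lambda>t. p t * mixw n i j t)"
        by (intro continuous_intros w Suc.prems)
      show "Ck (Suc n) k (\<lambda>x. integral {0..1} (?D j x))"
        by (intro Suc.IH Ck_partial[OF Suc.prems(1) m] pw)
      fix x :: "nat \<Rightarrow> real"
      have "((\<lambda>s. integral (cbox 0 1) (\<lambda>t. p t * h (mixpt n i t (x(j := s))))) has_real_derivative
         integral (cbox 0 1) (?D j (x(j := x j)))) (at (x j) within UNIV)"
      proof (rule leibniz_rule_field_derivative)
        fix s t :: real
        show "((\<lambda>s. p t * h (mixpt n i t (x(j := s)))) has_real_derivative ?D j (x(j := s)) t) (at s within UNIV)"
          using DERIV_cmult[OF mixpt_deriv[OF Suc.prems(1) assms j, of t x s], of "p t"]
          by (simp add: mult.assoc)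
        have "continuous_on UNIV (\<lambda>t::real. (x(j := s), t))" by (intro continuous_intros)
        from continuous_on_compose2[OF c[OF Suc.prems] this]
        have "continuous_on UNIV (\<lambda>t. p t * h (mixpt n i t (x(j := s))))" by simp
        then show "(\<lambda>t. p t * h (mixpt n i t (x(j := s)))) integrable_on cbox 0 1"
          by (intro integrable_continuous) (auto intro: continuous_on_subset)
      next
        have u: "continuous_on UNIV (\<lambda>z::real\<times>real. (x(j := fst z), snd z))"
        proof (intro continuous_on_Pair continuous_on_coordinatewise_then_product continuous_on_snd continuous_on_id)
          show "continuous_on UNIV (\<lambda>z::real\<times>real. (x(j := fst z)) i)" for i
            by (cases "i = j") (auto intro!: continuous_on_fst continuous_on_id)
        qed
        show "continuous_on (UNIV \<times> cbox 0 1) (\<lambda>(s, t). ?D j (x(j := s)) t)"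
          using continuous_on_compose2[OF c[OF Ck_partial[OF Suc.prems(1) m] pw] u]
          by (auto simp: case_prod_unfold intro: continuous_on_subset)
      qed auto
      then show "((\<lambda>s. integral {0..1} (\<lambda>t. p t * h (mixpt n i t (x(j := s))))) has_real_derivative
         integral {0..1} (?D j x)) (at (x j))" by simp
    qed (rule cont[OF Suc.prems])
  }
qed

definition hadamard :: "nat \<Rightarrow> nat \<Rightarrow> ((nat \<Rightarrow> real) \<Rightarrow> real) \<Rightarrow> (nat \<Rightarrow> real) \<Rightarrow> real"
  where "hadamard n i f = (\<lambda>x\<in>Rn (Suc n). integral {0..1} (\<lambda>t. partial n i f (mixpt n i t x)))"

lemma CinfI: "(\<And>k. Ck n k f) \<Longrightarrow> (\<lambda>x\<in>Rn n. f x) \<in> Cinf n"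
  unfolding Cinf_def using Ck_cong[of n "\<lambda>x\<in>Rn n. f x" f] by auto

lemma CinfD: "f \<in> Cinf n \<Longrightarrow> Ck n k f" "f \<in> Cinf n \<Longrightarrow> f \<in> extensional (Rn n)"
  by (auto simp: Cinf_def)

lemma hadamard_Cinf: assumes "f \<in> Cinf n" "i < n" shows "hadamard n i f \<in> Cinf (Suc n)"
  unfolding hadamard_def
proof (rule CinfI)
  fix k
  have "Ck n k (partial n i f)" using CinfD(1)[OF assms(1), of "Suc k"] assms(2) by simp
  from Ck_integral[OF assms(2) this, of "\<lambda>_. 1"]
  show "Ck (Suc n) k (\<lambda>x. integral {0..1} (\<lambda>t. partial n i f (mixpt n i t x)))" by simp
qed

lemma hadamard_eq:
  assumes "f \<in> Cinf n" "i < n" "x \<in> Rn (Suc n)"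
  shows "f (mixpt n i 1 x) = f (mixpt n i 0 x) + (x n - x i) * hadamard n i f x"
proof -
  have C: "Ck n 1 f" using assms CinfD by blast
  let ?g = "\<lambda>t. (x n - x i) * partial n i f (mixpt n i t x)"
  have d: "((\<lambda>t. f (mixpt n i t x)) has_real_derivative ?g t) (at t)" for t
  proof -
    have "((\<lambda>t. f ((mixpt n i 0 x)(i := (1 - t) * x i + t * x n))) has_real_derivative
       partial n i f ((mixpt n i 0 x)(i := (1 - t) * x i + t * x n)) * (x n - x i)) (at t)"
      by (rule DERIV_chain2[OF Ck_deriv_upd[OF C[unfolded One_nat_def] \<open>i < n\<close> mixpt_in[OF \<open>i < n\<close>]]])
         (auto intro!: derivative_eq_intros)
    moreover have "(mixpt n i 0 x)(i := (1 - t) * x i + t * x n) = mixpt n i t x" for t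
      by (auto simp: mixpt_def)
    ultimately show ?thesis by (simp add: mult.commute)
  qed
  have "(?g has_integral f (mixpt n i 1 x) - f (mixpt n i 0 x)) {0..1}"
    by (rule fundamental_theorem_of_calculus)
       (auto simp: has_real_derivative_iff_has_vector_derivative[symmetric]
             intro: has_field_derivative_at_within d)
  then have "integral {0..1} ?g = f (mixpt n i 1 x) - f (mixpt n i 0 x)" by (rule integral_unique)
  then show ?thesis using assms(3) by (simp add: hadamard_def)
qed

definition sm :: "nat \<Rightarrow> ((nat \<Rightarrow> real) \<Rightarrow> real) \<Rightarrow> bool"
  where "sm n f \<longleftrightarrow> (\<forall>k. Ck n k f)"

lemma sm_proj [simp]: "i < n \<Longrightarrow> sm n (\<lambda>x. x i)"
  and sm_const [simp]: "sm n (\<lambda>x. c)"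
  and sm_add [simp]: "sm n f \<Longrightarrow> sm n g \<Longrightarrow> sm n (\<lambda>x. f x + g x)"
  and sm_mult [simp]: "sm n f \<Longrightarrow> sm n g \<Longrightarrow> sm n (\<lambda>x. f x * g x)"
  by (simp_all add: sm_def Ck_proj Ck_const Ck_add Ck_mult)

lemma sm_uminus [simp]: "sm n f \<Longrightarrow> sm n (\<lambda>x. - f x)"
  using sm_mult[OF sm_const[of n "-1"], of f] by simp

lemma sm_diff [simp]: "sm n f \<Longrightarrow> sm n g \<Longrightarrow> sm n (\<lambda>x. f x - g x)"
  using sm_add[OF _ sm_uminus, of n f g] by simp

lemma Cinf_restrict: "sm n f \<Longrightarrow> restrict f (Rn n) \<in> Cinf n"
  by (simp add: sm_def CinfI)

lemma Cinf_sm: "f \<in> Cinf n \<Longrightarrow> sm n f"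
  by (simp add: sm_def CinfD)

lemma Cinf_eq_restrict: "f \<in> Cinf n \<Longrightarrow> restrict f (Rn n) = f"
  by (simp add: CinfD extensional_restrict)

lemma pair_in [simp]: "pair a b \<in> {..<2} \<rightarrow>\<^sub>E S \<longleftrightarrow> a \<in> S \<and> b \<in> S"
proof -
  have "{..<2::nat} = {0, 1}" by auto
  then show ?thesis by (auto simp: pair_def PiE_def Pi_def extensional_def)
qed

lemma pair_at [simp]: "pair a b 0 = a" "pair a b (Suc 0) = b"
  by (auto simp: pair_def)

lemma pair_comp: "(\<lambda>i\<in>{..<2}. F (pair a b i)) = pair (F a) (F b)"
  by (auto simp: pair_def fun_eq_iff)

lemma carrier_ring_of [simp]: "carrier (ring_of A) = carrier A"
  by (simp add: ring_of_def)

context cinf_ring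
begin

abbreviation (input) "R \<equiv> ring_of A"

lemma op_binary:
  assumes "h \<in> Cinf 2" "f \<in> Cinf n" "g \<in> Cinf n" "a \<in> {..<n} \<rightarrow>\<^sub>E carrier A"
  shows "smooth_op A 2 h (pair (smooth_op A n f a) (smooth_op A n g a)) =
         smooth_op A n (\<lambda>x\<in>Rn n. h (pair (f x) (g x))) a"
proof -
  have p: "pair f g j \<in> Cinf n" if "j < 2" for j
    using that assms(2,3) unfolding less_2_cases_iff by (elim disjE) simp_all
  have e: "smooth_op A n (\<lambda>x\<in>Rn n. h (\<lambda>j\<in>{..<2}. pair f g j x)) a =
     smooth_op A 2 h (\<lambda>j\<in>{..<2}. smooth_op A n (pair f g j) a)"
    by (rule op_comp[where h = h and g = "pair f g" and m = 2 and n = n, OF assms(1) p assms(4)])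
  have 1: "(\<lambda>j\<in>{..<2}. pair f g j x) = pair (f x) (g x)" for x
    by (rule pair_comp[of "\<lambda>f. f x"])
  have 2: "(\<lambda>j\<in>{..<2}. smooth_op A n (pair f g j) a) = pair (smooth_op A n f a) (smooth_op A n g a)"
    by (rule pair_comp[of "\<lambda>f. smooth_op A n f a"])
  show ?thesis using e unfolding 1 2 by (rule sym)
qed

lemma op_add:
  assumes "sm n f" "sm n g" "a \<in> {..<n} \<rightarrow>\<^sub>E carrier A"
  shows "smooth_op A n (restrict f (Rn n)) a \<oplus>\<^bsub>R\<^esub> smooth_op A n (restrict g (Rn n)) a =
    smooth_op A n (\<lambda>x\<in>Rn n. f x + g x) a"
proof -
  have c: "(\<lambda>x\<in>Rn 2. x 0 + x 1) \<in> Cinf 2" by (rule Cinf_restrict) simp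
  have "smooth_op A n (restrict f (Rn n)) a \<oplus>\<^bsub>R\<^esub> smooth_op A n (restrict g (Rn n)) a =
    smooth_op A n (\<lambda>x\<in>Rn n. (\<lambda>x\<in>Rn 2. x 0 + x 1) (pair (restrict f (Rn n) x) (restrict g (Rn n) x))) a"
    using op_binary[OF c Cinf_restrict[OF assms(1)] Cinf_restrict[OF assms(2)] assms(3)]
    by (simp only: ring_of_def ring_record_simps)
  also have "(\<lambda>x\<in>Rn n. (\<lambda>x\<in>Rn 2. x 0 + x 1) (pair (restrict f (Rn n) x) (restrict g (Rn n) x))) =
      (\<lambda>x\<in>Rn n. f x + g x)" by (rule restrict_ext) simp
  finally show ?thesis .
qed

lemma op_mult:
  assumes "sm n f" "sm n g" "a \<in> {..<n} \<rightarrow>\<^sub>E carrier A"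
  shows "smooth_op A n (restrict f (Rn n)) a \<otimes>\<^bsub>R\<^esub> smooth_op A n (restrict g (Rn n)) a =
    smooth_op A n (\<lambda>x\<in>Rn n. f x * g x) a"
proof -
  have c: "(\<lambda>x\<in>Rn 2. x 0 * x 1) \<in> Cinf 2" by (rule Cinf_restrict) simp
  have "smooth_op A n (restrict f (Rn n)) a \<otimes>\<^bsub>R\<^esub> smooth_op A n (restrict g (Rn n)) a =
    smooth_op A n (\<lambda>x\<in>Rn n. (\<lambda>x\<in>Rn 2. x 0 * x 1) (pair (restrict f (Rn n) x) (restrict g (Rn n) x))) a"
    using op_binary[OF c Cinf_restrict[OF assms(1)] Cinf_restrict[OF assms(2)] assms(3)]
    by (simp only: ring_of_def monoid.simps)
  also have "(\<lambda>x\<in>Rn n. (\<lambda>x\<in>Rn 2. x 0 * x 1) (pair (restrict f (Rn n) x) (restrict g (Rn n) x))) =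
      (\<lambda>x\<in>Rn n. f x * g x)" by (rule restrict_ext) simp
  finally show ?thesis .
qed

lemma op_const:
  assumes "a \<in> {..<n} \<rightarrow>\<^sub>E carrier A"
  shows "smooth_op A 0 (\<lambda>x\<in>Rn 0. c) (\<lambda>i\<in>{..<0}. undefined) = smooth_op A n (\<lambda>x\<in>Rn n. c) a"
proof -
  have e: "smooth_op A n (\<lambda>x\<in>Rn n. (\<lambda>x\<in>Rn 0. c) (\<lambda>j\<in>{..<0::nat}. undefined)) a =
     smooth_op A 0 (\<lambda>x\<in>Rn 0. c) (\<lambda>j\<in>{..<0}. smooth_op A n (\<lambda>x. undefined) a)"
    by (rule op_comp[where h = "\<lambda>x\<in>Rn 0. c" and g = "\<lambda>j x. undefined" and m = 0 and n = n])
       (simp_all only: Cinf_restrict sm_const assms not_less0)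
  have 1: "(\<lambda>j\<in>{..<0::nat}. smooth_op A n (\<lambda>x. undefined) a) = (\<lambda>i\<in>{..<0::nat}. undefined)"
    by (rule ext) simp
  have 2: "(\<lambda>x\<in>Rn 0. c) (\<lambda>j\<in>{..<0}. undefined) = c" by simp
  show ?thesis using e unfolding 1 2 by (rule sym)
qed

lemma op_zero: "a \<in> {..<n} \<rightarrow>\<^sub>E carrier A \<Longrightarrow> \<zero>\<^bsub>R\<^esub> = smooth_op A n (\<lambda>x\<in>Rn n. 0) a"
  unfolding ring_of_def ring_record_simps by (rule op_const)

lemma op_one: "a \<in> {..<n} \<rightarrow>\<^sub>E carrier A \<Longrightarrow> \<one>\<^bsub>R\<^esub> = smooth_op A n (\<lambda>x\<in>Rn n. 1) a"
  unfolding ring_of_def ring_record_simps monoid.simps by (rule op_const)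

lemma triple:
  assumes "a \<in> carrier A" "b \<in> carrier A" "c \<in> carrier A"
  obtains t where "t \<in> {..<3::nat} \<rightarrow>\<^sub>E carrier A"
    "a = smooth_op A 3 (\<lambda>x\<in>Rn 3. x 0) t" "b = smooth_op A 3 (\<lambda>x\<in>Rn 3. x 1) t"
    "c = smooth_op A 3 (\<lambda>x\<in>Rn 3. x 2) t"
proof
  let ?t = "\<lambda>i\<in>{..<3::nat}. if i = 0 then a else if i = 1 then b else c"
  show t: "?t \<in> {..<3} \<rightarrow>\<^sub>E carrier A" using assms by auto
  show "a = smooth_op A 3 (\<lambda>x\<in>Rn 3. x 0) ?t" "b = smooth_op A 3 (\<lambda>x\<in>Rn 3. x 1) ?t"
    "c = smooth_op A 3 (\<lambda>x\<in>Rn 3. x 2) ?t"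
    using op_proj[of 0 3, OF _ t] op_proj[of 1 3, OF _ t] op_proj[of 2 3, OF _ t] by simp_all
qed

lemma ring_of_closed:
  "a \<in> carrier A \<Longrightarrow> b \<in> carrier A \<Longrightarrow> a \<oplus>\<^bsub>R\<^esub> b \<in> carrier A"
  "a \<in> carrier A \<Longrightarrow> b \<in> carrier A \<Longrightarrow> a \<otimes>\<^bsub>R\<^esub> b \<in> carrier A"
  "\<zero>\<^bsub>R\<^esub> \<in> carrier A" "\<one>\<^bsub>R\<^esub> \<in> carrier A"
proof -
  show "\<zero>\<^bsub>R\<^esub> \<in> carrier A"
    unfolding ring_of_def ring_record_simps by (rule op_closed) (simp_all add: Cinf_restrict del: lessThan_0)
  show "\<one>\<^bsub>R\<^esub> \<in> carrier A"
    unfolding ring_of_def monoid.simps by (rule op_closed) (simp_all add: Cinf_restrict del: lessThan_0)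
  assume "a \<in> carrier A" "b \<in> carrier A"
  then have p: "pair a b \<in> {..<2} \<rightarrow>\<^sub>E carrier A" by simp
  show "a \<oplus>\<^bsub>R\<^esub> b \<in> carrier A"
    unfolding ring_of_def ring_record_simps
    by (rule op_closed[OF Cinf_restrict p]) simp
  show "a \<otimes>\<^bsub>R\<^esub> b \<in> carrier A"
    unfolding ring_of_def monoid.simps
    by (rule op_closed[OF Cinf_restrict p]) simp
qed

lemma ring_of_cring: "cring R"
proof (rule cringI)
  show "abelian_group R"
  proof (rule abelian_groupI, unfold carrier_ring_of)
    fix a b c assume abc: "a \<in> carrier A" "b \<in> carrier A" "c \<in> carrier A"
    then obtain t where t: "t \<in> {..<3} \<rightarrow>\<^sub>E carrier A"
      and e: "a = smooth_op A 3 (\<lambda>x\<in>Rn 3. x 0) t" "b = smooth_op A 3 (\<lambda>x\<in>Rn 3. x 1) t"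
      "c = smooth_op A 3 (\<lambda>x\<in>Rn 3. x 2) t" by (rule triple)
    show "(a \<oplus>\<^bsub>R\<^esub> b) \<oplus>\<^bsub>R\<^esub> c = a \<oplus>\<^bsub>R\<^esub> (b \<oplus>\<^bsub>R\<^esub> c)"
      unfolding e by (simp add: op_add t add.assoc)
  next
    fix a b assume abc: "a \<in> carrier A" "b \<in> carrier A"
    obtain t where t: "t \<in> {..<3} \<rightarrow>\<^sub>E carrier A"
      and e: "a = smooth_op A 3 (\<lambda>x\<in>Rn 3. x 0) t" "b = smooth_op A 3 (\<lambda>x\<in>Rn 3. x 1) t"
      using triple[OF abc(1) abc(2) abc(2)] by metis
    show "a \<oplus>\<^bsub>R\<^esub> b = b \<oplus>\<^bsub>R\<^esub> a"
      unfolding e by (simp add: op_add t add.commute)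
  next
    fix a assume abc: "a \<in> carrier A"
    obtain t where t: "t \<in> {..<3} \<rightarrow>\<^sub>E carrier A"
      and e: "a = smooth_op A 3 (\<lambda>x\<in>Rn 3. x 0) t"
      using triple[OF abc abc abc] by metis
    show "\<zero>\<^bsub>R\<^esub> \<oplus>\<^bsub>R\<^esub> a = a"
      unfolding e op_zero[OF t] by (simp add: op_add t)
    show "\<exists>y\<in>carrier A. y \<oplus>\<^bsub>R\<^esub> a = \<zero>\<^bsub>R\<^esub>"
    proof
      show "smooth_op A 3 (\<lambda>x\<in>Rn 3. - x 0) t \<in> carrier A"
        by (rule op_closed[OF Cinf_restrict t]) simp
      show "smooth_op A 3 (\<lambda>x\<in>Rn 3. - x 0) t \<oplus>\<^bsub>R\<^esub> a = \<zero>\<^bsub>R\<^esub>"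
        unfolding e op_zero[OF t] by (simp add: op_add t)
    qed
  qed (auto intro: ring_of_closed)
  show "comm_monoid R"
  proof (rule comm_monoidI, unfold carrier_ring_of)
    fix a b c assume abc: "a \<in> carrier A" "b \<in> carrier A" "c \<in> carrier A"
    then obtain t where t: "t \<in> {..<3} \<rightarrow>\<^sub>E carrier A"
      and e: "a = smooth_op A 3 (\<lambda>x\<in>Rn 3. x 0) t" "b = smooth_op A 3 (\<lambda>x\<in>Rn 3. x 1) t"
      "c = smooth_op A 3 (\<lambda>x\<in>Rn 3. x 2) t" by (rule triple)
    show "(a \<otimes>\<^bsub>R\<^esub> b) \<otimes>\<^bsub>R\<^esub> c = a \<otimes>\<^bsub>R\<^esub> (b \<otimes>\<^bsub>R\<^esub> c)"
      unfolding e by (simp add: op_mult t mult.assoc)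
  next
    fix a b assume abc: "a \<in> carrier A" "b \<in> carrier A"
    obtain t where t: "t \<in> {..<3} \<rightarrow>\<^sub>E carrier A"
      and e: "a = smooth_op A 3 (\<lambda>x\<in>Rn 3. x 0) t" "b = smooth_op A 3 (\<lambda>x\<in>Rn 3. x 1) t"
      using triple[OF abc(1) abc(2) abc(2)] by metis
    show "a \<otimes>\<^bsub>R\<^esub> b = b \<otimes>\<^bsub>R\<^esub> a"
      unfolding e by (simp add: op_mult t mult.commute)
  next
    fix a assume abc: "a \<in> carrier A"
    obtain t where t: "t \<in> {..<3} \<rightarrow>\<^sub>E carrier A"
      and e: "a = smooth_op A 3 (\<lambda>x\<in>Rn 3. x 0) t"
      using triple[OF abc abc abc] by metis
    show "\<one>\<^bsub>R\<^esub> \<otimes>\<^bsub>R\<^esub> a = a"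
      unfolding e op_one[OF t] by (simp add: op_mult t)
  qed (auto intro: ring_of_closed)
  fix a b c assume "a \<in> carrier R" "b \<in> carrier R" "c \<in> carrier R"
  then obtain t where t: "t \<in> {..<3} \<rightarrow>\<^sub>E carrier A"
    and e: "a = smooth_op A 3 (\<lambda>x\<in>Rn 3. x 0) t" "b = smooth_op A 3 (\<lambda>x\<in>Rn 3. x 1) t"
    "c = smooth_op A 3 (\<lambda>x\<in>Rn 3. x 2) t" unfolding carrier_ring_of by (rule triple)
  show "(a \<oplus>\<^bsub>R\<^esub> b) \<otimes>\<^bsub>R\<^esub> c = a \<otimes>\<^bsub>R\<^esub> c \<oplus>\<^bsub>R\<^esub> b \<otimes>\<^bsub>R\<^esub> c"
    unfolding e by (simp add: op_add op_mult t distrib_right)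
qed

sublocale R: cring R by (rule ring_of_cring)

lemma ideal_op_single:
  assumes I: "ideal I R" and f: "f \<in> Cinf n" and a: "a \<in> {..<n} \<rightarrow>\<^sub>E carrier A"
    and i: "i < n" and v: "v \<in> carrier A" and d: "v \<ominus>\<^bsub>R\<^esub> a i \<in> I"
  shows "smooth_op A n f (a(i := v)) \<ominus>\<^bsub>R\<^esub> smooth_op A n f a \<in> I"
proof -
  interpret I: ideal I R by fact
  define b where "b = a(n := v)"
  have b: "b \<in> {..<Suc n} \<rightarrow>\<^sub>E carrier A"
    using a v by (auto simp: b_def PiE_def Pi_def extensional_def)
  let ?P = "\<lambda>j. \<lambda>x\<in>Rn (Suc n). x j"
  let ?F = "\<lambda>s. \<lambda>x\<in>Rn (Suc n). f (mixpt n i s x)"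
  have F: "?F s \<in> Cinf (Suc n)" for s
    by (rule CinfI) (rule Ck_mix[OF i CinfD(1)[OF f]])
  have H: "hadamard n i f \<in> Cinf (Suc n)" by (rule hadamard_Cinf[OF f i])
  have sel: "smooth_op A (Suc n) (\<lambda>x\<in>Rn (Suc n). f (\<lambda>j\<in>{..<n}. ?P (p j) x)) b =
      smooth_op A n f (\<lambda>j\<in>{..<n}. b (p j))" if p: "\<And>j. j < n \<Longrightarrow> p j < Suc n" for p
  proof -
    have "smooth_op A (Suc n) (\<lambda>x\<in>Rn (Suc n). f (\<lambda>j\<in>{..<n}. ?P (p j) x)) b =
      smooth_op A n f (\<lambda>j\<in>{..<n}. smooth_op A (Suc n) (?P (p j)) b)"
      by (rule op_comp[where h = f and g = "\<lambda>j. ?P (p j)" and m = n and n = "Suc n", OF f _ b])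
         (rule Cinf_restrict, rule sm_proj, rule p)
    also have "(\<lambda>j\<in>{..<n}. smooth_op A (Suc n) (?P (p j)) b) = (\<lambda>j\<in>{..<n}. b (p j))"
      by (rule restrict_ext) (use op_proj[OF p b] in auto)
    finally show ?thesis .
  qed
  have "(\<lambda>x\<in>Rn (Suc n). f (\<lambda>j\<in>{..<n}. ?P (if j = i then n else j) x)) = ?F 1"
    by (intro restrict_ext arg_cong[of _ _ f]) (use i in \<open>auto simp: mixpt_def fun_eq_iff\<close>)
  with sel[of "\<lambda>j. if j = i then n else j"]
  have 1: "smooth_op A (Suc n) (?F 1) b = smooth_op A n f (\<lambda>j\<in>{..<n}. b (if j = i then n else j))"
    by simp
  have "(\<lambda>j\<in>{..<n}. b (if j = i then n else j)) = a(i := v)"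
    using a i by (auto simp: b_def fun_eq_iff PiE_def extensional_def)
  with 1 have 1: "smooth_op A (Suc n) (?F 1) b = smooth_op A n f (a(i := v))" by simp
  have "(\<lambda>x\<in>Rn (Suc n). f (\<lambda>j\<in>{..<n}. ?P j x)) = ?F 0"
    by (intro restrict_ext arg_cong[of _ _ f]) (use i in \<open>auto simp: mixpt_def fun_eq_iff\<close>)
  with sel[of "\<lambda>j. j"]
  have 0: "smooth_op A (Suc n) (?F 0) b = smooth_op A n f (\<lambda>j\<in>{..<n}. b j)" by simp
  have "(\<lambda>j\<in>{..<n}. b j) = a"
    using a by (auto simp: b_def fun_eq_iff PiE_def extensional_def)
  with 0 have 0: "smooth_op A (Suc n) (?F 0) b = smooth_op A n f a" by simp
  let ?D = "\<lambda>x\<in>Rn (Suc n). x n - x i"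
  let ?H = "hadamard n i f"
  have sm: "sm (Suc n) (\<lambda>x. x n - x i)" "sm (Suc n) (\<lambda>x. f (mixpt n i s x))" "sm (Suc n) ?H" for s
    using i Ck_mix[OF i CinfD(1)[OF f]] Cinf_sm[OF H] by (simp_all add: sm_def[of _ "\<lambda>x. f (mixpt n i s x)"])
  have D: "?D \<in> Cinf (Suc n)"
    by (rule Cinf_restrict[OF sm(1)])
  have bi: "b n = smooth_op A (Suc n) (?P n) b" "b i = smooth_op A (Suc n) (?P i) b"
    using op_proj[OF _ b] i by auto
  have "smooth_op A (Suc n) ?D b \<oplus>\<^bsub>R\<^esub> b i = b n"
    unfolding bi using i op_add[OF sm(1) _ b, of "\<lambda>x. x i"] by simp
  then have "smooth_op A (Suc n) ?D b \<oplus>\<^bsub>R\<^esub> a i = v" using i by (simp add: b_def)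
  moreover have "smooth_op A (Suc n) ?D b \<in> carrier A" "a i \<in> carrier A"
    using op_closed[OF D b] a i by auto
  moreover have "(p \<oplus>\<^bsub>R\<^esub> q) \<ominus>\<^bsub>R\<^esub> q = p" if "p \<in> carrier R" "q \<in> carrier R" for p q
    using that by algebra
  ultimately have Dv: "smooth_op A (Suc n) ?D b = v \<ominus>\<^bsub>R\<^esub> a i"
    by (metis carrier_ring_of)
  have "?F 1 = (\<lambda>x\<in>Rn (Suc n). f (mixpt n i 0 x) + (x n - x i) * ?H x)"
    by (rule restrict_ext) (use hadamard_eq[OF f i] in simp)
  then have "smooth_op A (Suc n) (?F 1) b = smooth_op A (Suc n) (?F 0) b \<oplus>\<^bsub>R\<^esub>
      smooth_op A (Suc n) ?D b \<otimes>\<^bsub>R\<^esub> smooth_op A (Suc n) (restrict ?H (Rn (Suc n))) b"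
    by (simp only: op_add op_mult sm sm_mult b)
  then have "smooth_op A (Suc n) (?F 1) b = smooth_op A (Suc n) (?F 0) b \<oplus>\<^bsub>R\<^esub>
      smooth_op A (Suc n) ?D b \<otimes>\<^bsub>R\<^esub> smooth_op A (Suc n) ?H b"
    unfolding Cinf_eq_restrict[OF H] .
  then have e: "smooth_op A n f (a(i := v)) = smooth_op A n f a \<oplus>\<^bsub>R\<^esub>
      (v \<ominus>\<^bsub>R\<^esub> a i) \<otimes>\<^bsub>R\<^esub> smooth_op A (Suc n) (hadamard n i f) b"
    unfolding 0 1 Dv .
  have m: "(v \<ominus>\<^bsub>R\<^esub> a i) \<otimes>\<^bsub>R\<^esub> smooth_op A (Suc n) (hadamard n i f) b \<in> I"
    by (rule I.I_r_closed[OF d]) (simp add: op_closed[OF H b])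
  have c: "smooth_op A n f a \<in> carrier R" by (simp add: op_closed[OF f a])
  have "smooth_op A n f (a(i := v)) \<ominus>\<^bsub>R\<^esub> smooth_op A n f a =
      (v \<ominus>\<^bsub>R\<^esub> a i) \<otimes>\<^bsub>R\<^esub> smooth_op A (Suc n) (hadamard n i f) b"
    unfolding e using c I.a_subset m
    by (metis R.a_comm R.add.inv_solve_right' R.add.m_closed R.minus_eq subsetD)
  with m show ?thesis by simp
qed

lemma ideal_op:
  assumes I: "ideal I R" and f: "f \<in> Cinf n" and a: "a \<in> {..<n} \<rightarrow>\<^sub>E carrier A"
    and b: "b \<in> {..<n} \<rightarrow>\<^sub>E carrier A" and d: "\<And>i. i < n \<Longrightarrow> b i \<ominus>\<^bsub>R\<^esub> a i \<in> I"
  shows "smooth_op A n f b \<ominus>\<^bsub>R\<^esub> smooth_op A n f a \<in> I"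
proof -
  interpret I: ideal I R by fact
  define c where "c k = (\<lambda>i. if i < k then b i else a i)" for k
  have c: "c k \<in> {..<n} \<rightarrow>\<^sub>E carrier A" if "k \<le> n" for k
    using a b that by (auto simp: c_def PiE_def Pi_def extensional_def)
  have "smooth_op A n f (c k) \<ominus>\<^bsub>R\<^esub> smooth_op A n f a \<in> I" if "k \<le> n" for k
    using that
  proof (induction k)
    case 0
    have "c 0 = a" by (auto simp: c_def)
    then show ?case using op_closed[OF f a] I.zero_closed by (simp add: R.minus_eq R.r_neg)
  next
    case (Suc k)
    have eq: "c (Suc k) = (c k)(k := b k)" by (auto simp: c_def fun_eq_iff less_Suc_eq)
    have "smooth_op A n f (c (Suc k)) \<ominus>\<^bsub>R\<^esub> smooth_op A n f (c k) \<in> I"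
      unfolding eq
    proof (rule ideal_op_single[OF I f c])
      have k: "k < n" using Suc.prems by simp
      then show "k < n" "k \<le> n" by simp_all
      show "b k \<in> carrier A" using b k by blast
      have "c k k = a k" by (simp add: c_def)
      with d[OF k] show "b k \<ominus>\<^bsub>R\<^esub> c k k \<in> I" by simp
    qed
    from I.a_closed[OF this Suc.IH] Suc.prems
    have 1: "(smooth_op A n f (c (Suc k)) \<ominus>\<^bsub>R\<^esub> smooth_op A n f (c k)) \<oplus>\<^bsub>R\<^esub>
       (smooth_op A n f (c k) \<ominus>\<^bsub>R\<^esub> smooth_op A n f a) \<in> I" by simp
    have "(p \<ominus>\<^bsub>R\<^esub> q) \<oplus>\<^bsub>R\<^esub> (q \<ominus>\<^bsub>R\<^esub> r) = p \<ominus>\<^bsub>R\<^esub> r"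
      if "p \<in> carrier R" "q \<in> carrier R" "r \<in> carrier R" for p q r
      using that by algebra
    from this[of "smooth_op A n f (c (Suc k))" "smooth_op A n f (c k)" "smooth_op A n f a"] 1 Suc.prems
    show ?case by (simp add: op_closed[OF f a] op_closed[OF f c])
  qed
  from this[of n] have "smooth_op A n f (c n) \<ominus>\<^bsub>R\<^esub> smooth_op A n f a \<in> I" by simp
  moreover have "c n = b" using a b by (auto simp: c_def fun_eq_iff PiE_def extensional_def)
  ultimately show ?thesis by simp
qed

end

definition telpt :: "nat \<Rightarrow> nat \<Rightarrow> (nat \<Rightarrow> real) \<Rightarrow> (nat \<Rightarrow> real) \<Rightarrow> nat \<Rightarrow> real"
  where "telpt m j y z = (\<lambda>i\<in>{..<Suc m}. if i = m then z j else if i < j then z i else y i)"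

lemma telescope:
  assumes h: "h \<in> Cinf m" and y: "y \<in> Rn m" and z: "z \<in> Rn m"
  shows "h z - h y = (\<Sum>j<m. (z j - y j) * hadamard m j h (telpt m j y z))"
proof -
  define c where "c k = (\<lambda>i. if i < k then z i else y i)" for k
  have step: "h (c (Suc j)) - h (c j) = (z j - y j) * hadamard m j h (telpt m j y z)" if j: "j < m" for j
  proof -
    have t: "telpt m j y z \<in> Rn (Suc m)" by (simp add: telpt_def)
    have "mixpt m j 1 (telpt m j y z) = c (Suc j)" "mixpt m j 0 (telpt m j y z) = c j"
      using j y z by (auto simp: mixpt_def telpt_def c_def fun_eq_iff PiE_def extensional_def)
    moreover have "telpt m j y z m = z j" "telpt m j y z j = y j" using j by (simp_all add: telpt_def)
    ultimately show ?thesis using hadamard_eq[OF h j t] by simp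
  qed
  have "(\<Sum>j<m. h (c (Suc j)) - h (c j)) = h (c m) - h (c 0)" by (rule sum_lessThan_telescope)
  moreover have "c m = z" using y z by (auto simp: c_def fun_eq_iff PiE_def extensional_def)
  moreover have "c 0 = y" by (simp add: c_def)
  ultimately show ?thesis using step by simp
qed

lemma hadamard_diag:
  assumes "j < m" "y \<in> Rn m"
  shows "hadamard m j h (telpt m j y y) = partial m j h y"
proof -
  have "telpt m j y y \<in> Rn (Suc m)" by (simp add: telpt_def)
  moreover have "mixpt m j t (telpt m j y y) = y" for t
    using assms by (auto simp: mixpt_def telpt_def fun_eq_iff PiE_def extensional_def algebra_simps)
  ultimately show ?thesis by (simp add: hadamard_def)
qed

lemma chain_rule:
  assumes h: "h \<in> Cinf m" and G: "\<And>j s. j < m \<Longrightarrow> (G j has_real_derivative G' j s) (at s)"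
  shows "((\<lambda>s. h (\<lambda>j\<in>{..<m}. G j s)) has_real_derivative
     (\<Sum>j<m. G' j u * partial m j h (\<lambda>j\<in>{..<m}. G j u))) (at u)"
proof -
  define P where "P s = (\<lambda>j\<in>{..<m}. G j s)" for s
  have P: "P s \<in> Rn m" for s by (simp add: P_def)
  have Pj: "P s j = G j s" if "j < m" for s j using that by (simp add: P_def)
  have "\<forall>j\<in>{..<m}. \<exists>g. (\<forall>z. G j z - G j u = g z * (z - u)) \<and> isCont g u \<and> g u = G' j u"
    using G CARAT_DERIV by blast
  then obtain g where g: "\<And>j z. j < m \<Longrightarrow> G j z - G j u = g j z * (z - u)"
    "\<And>j. j < m \<Longrightarrow> isCont (g j) u" "\<And>j. j < m \<Longrightarrow> g j u = G' j u"
    by (metis lessThan_iff)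
  let ?H = "\<lambda>j z. hadamard m j h (telpt m j (P u) (P z))"
  have "h (P z) - h (P u) = (\<Sum>j<m. g j z * ?H j z) * (z - u)" for z
    unfolding telescope[OF h P P] sum_distrib_right
    by (rule sum.cong) (auto simp: Pj g)
  moreover have "isCont (\<lambda>z. \<Sum>j<m. g j z * ?H j z) u"
  proof (intro continuous_intros)
    fix j assume "j \<in> {..<m}"
    then have j: "j < m" by simp
    have Gc: "continuous_on UNIV (G i)" if "i < m" for i
      using G[OF that] by (auto intro: DERIV_continuous_on)
    have "continuous_on UNIV (\<lambda>z. telpt m j (P u) (P z))"
    proof (rule continuous_on_coordinatewise_then_product)
      fix i
      show "continuous_on UNIV (\<lambda>z. telpt m j (P u) (P z) i)"
        using j by (cases "i < Suc m"; cases "i = m"; cases "i < j")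
          (simp_all add: telpt_def Pj Gc)
    qed
    moreover have "continuous_on UNIV (\<lambda>x. hadamard m j h (restrict x {..<Suc m}))"
      using Ck_cont[OF CinfD(1)[OF hadamard_Cinf[OF h j]]] cont_iff by blast
    ultimately have "continuous_on UNIV (\<lambda>z. hadamard m j h (restrict (telpt m j (P u) (P z)) {..<Suc m}))"
      using continuous_on_compose2[of UNIV "\<lambda>x. hadamard m j h (restrict x {..<Suc m})"] by blast
    moreover have "restrict (telpt m j (P u) (P z)) {..<Suc m} = telpt m j (P u) (P z)" for z
      by (rule ext) (simp add: telpt_def)
    ultimately show "isCont (\<lambda>z. ?H j z) u" by (simp add: continuous_on_eq_continuous_at)
    show "isCont (g j) u" by (rule g(2)[OF j])
  qed
  moreover have "(\<Sum>j<m. g j u * ?H j u) = (\<Sum>j<m. G' j u * partial m j h (P u))"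
    by (rule sum.cong) (simp_all add: g(3) hadamard_diag[OF _ P])
  ultimately have "((\<lambda>s. h (P s)) has_real_derivative (\<Sum>j<m. G' j u * partial m j h (P u))) (at u)"
    unfolding CARAT_DERIV by (intro exI[of _ "\<lambda>z. \<Sum>j<m. g j z * ?H j z"]) simp
  then show ?thesis unfolding P_def .
qed

lemma Ck_sum: "finite S \<Longrightarrow> (\<And>j. j \<in> S \<Longrightarrow> Ck n k (f j)) \<Longrightarrow> Ck n k (\<lambda>x. \<Sum>j\<in>S. f j x)"
  by (induction S rule: finite_induct) (simp_all add: Ck_const Ck_add)

lemma Cinf_partial: "f \<in> Cinf n \<Longrightarrow> i < n \<Longrightarrow> partial n i f \<in> Cinf n"
  unfolding Cinf_def[of n] mem_Collect_eq
proof (intro conjI allI)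
  assume "f \<in> extensional (Rn n) \<and> (\<forall>k. Ck n k f)" and i: "i < n"
  then show "Ck n k (partial n i f)" for k using Ck_partial[of n k f i] by blast
  show "partial n i f \<in> extensional (Rn n)" by (simp add: partial_def)
qed

lemma Ck_comp:
  assumes "\<And>j. j < m \<Longrightarrow> g j \<in> Cinf n"
  shows "h \<in> Cinf m \<Longrightarrow> Ck n k (\<lambda>x. h (\<lambda>j\<in>{..<m}. g j x))"
proof (induction k arbitrary: h)
  have cont: "continuous_map (powertop_real {..<n}) euclideanreal (\<lambda>x. h (\<lambda>j\<in>{..<m}. g j x))"
    if "h \<in> Cinf m" for h
  proof -
    have gc: "continuous_map (powertop_real {..<n}) (powertop_real {..<m}) (\<lambda>x. \<lambda>j\<in>{..<m}. g j x)"
      using Ck_cont[OF CinfD(1)[OF assms]] by (auto simp: continuous_map_componentwise)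
    show ?thesis
      using continuous_map_compose[OF gc Ck_cont[OF CinfD(1)[OF that]]] by (simp add: o_def)
  qed
  {
    case 0 show ?case unfolding Ck.simps by (rule cont[OF 0])
  next
    case (Suc k)
    show ?case
    proof (rule Ck_SucI[where D = "\<lambda>i x. \<Sum>j<m. partial n i (g j) x * partial m j h (\<lambda>j\<in>{..<m}. g j x)"])
      fix i assume i: "i < n"
      show "Ck n k (\<lambda>x. \<Sum>j<m. partial n i (g j) x * partial m j h (\<lambda>j\<in>{..<m}. g j x))"
      proof (rule Ck_sum)
        fix j assume "j \<in> {..<m}"
        then have j: "j < m" by simp
        show "Ck n k (\<lambda>x. partial n i (g j) x * partial m j h (\<lambda>j\<in>{..<m}. g j x))"
          by (rule Ck_mult[OF CinfD(1)[OF Cinf_partial[OF assms[OF j] i]] Suc.IH[OF Cinf_partial[OF Suc.prems j]]])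
      qed simp
      fix x assume x: "x \<in> Rn n"
      have d: "((\<lambda>s. g j (x(i := s))) has_real_derivative partial n i (g j) (x(i := u))) (at u)" if "j < m" for j u
        by (rule Ck_deriv_upd[OF CinfD(1)[OF assms[OF that]] i x])
      have "((\<lambda>s. h (\<lambda>j\<in>{..<m}. g j (x(i := s)))) has_real_derivative
         (\<Sum>j<m. partial n i (g j) (x(i := x i)) * partial m j h (\<lambda>j\<in>{..<m}. g j (x(i := x i))))) (at (x i))"
        by (rule chain_rule[OF Suc.prems, where G = "\<lambda>j s. g j (x(i := s))"]) (rule d)
      then show "((\<lambda>s. h (\<lambda>j\<in>{..<m}. g j (x(i := s)))) has_real_derivative
         (\<Sum>j<m. partial n i (g j) x * partial m j h (\<lambda>j\<in>{..<m}. g j x))) (at (x i))"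
        by simp
    qed (rule cont[OF Suc.prems])
  }
qed

lemma Cinf_comp:
  assumes "h \<in> Cinf m" "\<And>j. j < m \<Longrightarrow> g j \<in> Cinf n"
  shows "(\<lambda>x\<in>Rn n. h (\<lambda>j\<in>{..<m}. g j x)) \<in> Cinf n"
  by (rule CinfI) (rule Ck_comp[OF assms(2,1)])

lemma cinf_homI:
  assumes "\<And>a. a \<in> carrier A \<Longrightarrow> \<phi> a \<in> carrier B"
    and "\<And>n f a. f \<in> Cinf n \<Longrightarrow> a \<in> {..<n} \<rightarrow>\<^sub>E carrier A \<Longrightarrow>
      \<phi> (smooth_op A n f a) = smooth_op B n f (\<lambda>i\<in>{..<n}. \<phi> (a i))"
  shows "\<phi> \<in> cinf_hom A B"
  using assms unfolding cinf_hom_def by blast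

lemma cinf_hom_closed: "\<phi> \<in> cinf_hom A B \<Longrightarrow> a \<in> carrier A \<Longrightarrow> \<phi> a \<in> carrier B"
  unfolding cinf_hom_def by blast

lemma cinf_hom_op:
  "\<phi> \<in> cinf_hom A B \<Longrightarrow> f \<in> Cinf n \<Longrightarrow> a \<in> {..<n} \<rightarrow>\<^sub>E carrier A \<Longrightarrow>
   \<phi> (smooth_op A n f a) = smooth_op B n f (\<lambda>i\<in>{..<n}. \<phi> (a i))"
  unfolding cinf_hom_def by blast

lemma PiE_hom:
  "\<phi> \<in> cinf_hom A B \<Longrightarrow> a \<in> {..<n} \<rightarrow>\<^sub>E carrier A \<Longrightarrow> (\<lambda>i\<in>{..<n}. \<phi> (a i)) \<in> {..<n} \<rightarrow>\<^sub>E carrier B"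
  by (auto intro!: cinf_hom_closed[of \<phi> A B])

lemma cinf_hom_comp:
  assumes "\<phi> \<in> cinf_hom A B" "\<psi> \<in> cinf_hom B C"
  shows "(\<lambda>a. \<psi> (\<phi> a)) \<in> cinf_hom A C"
proof (rule cinf_homI)
  show "\<psi> (\<phi> a) \<in> carrier C" if "a \<in> carrier A" for a
    using that cinf_hom_closed assms by metis
  fix n f a assume f: "f \<in> Cinf n" and a: "a \<in> {..<n} \<rightarrow>\<^sub>E carrier A"
  have "\<psi> (\<phi> (smooth_op A n f a)) = smooth_op C n f (\<lambda>i\<in>{..<n}. \<psi> ((\<lambda>i\<in>{..<n}. \<phi> (a i)) i))"
    unfolding cinf_hom_op[OF assms(1) f a] by (rule cinf_hom_op[OF assms(2) f PiE_hom[OF assms(1) a]])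
  also have "(\<lambda>i\<in>{..<n}. \<psi> ((\<lambda>i\<in>{..<n}. \<phi> (a i)) i)) = (\<lambda>i\<in>{..<n}. \<psi> (\<phi> (a i)))"
    by (rule restrict_ext) simp
  finally show "\<psi> (\<phi> (smooth_op A n f a)) = smooth_op C n f (\<lambda>i\<in>{..<n}. \<psi> (\<phi> (a i)))" .
qed

lemma cinf_hom_restrict:
  assumes "cinf_ring A" "\<phi> \<in> cinf_hom A B" "\<And>a. a \<in> carrier A \<Longrightarrow> \<psi> a = \<phi> a"
  shows "\<psi> \<in> cinf_hom A B"
proof (rule cinf_homI)
  show "\<psi> a \<in> carrier B" if "a \<in> carrier A" for a
    using that assms(3) cinf_hom_closed[OF assms(2)] by simp
  fix n f a assume f: "f \<in> Cinf n" and a: "a \<in> {..<n} \<rightarrow>\<^sub>E carrier A"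
  have "(\<lambda>i\<in>{..<n}. \<psi> (a i)) = (\<lambda>i\<in>{..<n}. \<phi> (a i))"
    by (rule restrict_ext) (use a in \<open>auto intro: assms(3)\<close>)
  then show "\<psi> (smooth_op A n f a) = smooth_op B n f (\<lambda>i\<in>{..<n}. \<psi> (a i))"
    using assms(3)[OF cinf_ring.op_closed[OF assms(1) f a]] cinf_hom_op[OF assms(2) f a] by simp
qed

lemma cinf_hom_ring:
  assumes "\<phi> \<in> cinf_hom A B"
  shows "a \<in> carrier A \<Longrightarrow> b \<in> carrier A \<Longrightarrow> \<phi> (a \<oplus>\<^bsub>ring_of A\<^esub> b) = \<phi> a \<oplus>\<^bsub>ring_of B\<^esub> \<phi> b"
    and "a \<in> carrier A \<Longrightarrow> b \<in> carrier A \<Longrightarrow> \<phi> (a \<otimes>\<^bsub>ring_of A\<^esub> b) = \<phi> a \<otimes>\<^bsub>ring_of B\<^esub> \<phi> b"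
    and "\<phi> \<zero>\<^bsub>ring_of A\<^esub> = \<zero>\<^bsub>ring_of B\<^esub>"
    and "\<phi> \<one>\<^bsub>ring_of A\<^esub> = \<one>\<^bsub>ring_of B\<^esub>"
proof -
  have e: "(\<lambda>i\<in>{..<0::nat}. undefined) \<in> {..<0} \<rightarrow>\<^sub>E carrier A" by simp
  have e2: "(\<lambda>i\<in>{..<0::nat}. \<phi> ((\<lambda>i\<in>{..<0}. undefined) i)) = (\<lambda>i\<in>{..<0}. undefined)"
    by (rule ext) simp
  have k: "\<phi> (smooth_op A 0 (\<lambda>x\<in>Rn 0. c) (\<lambda>i\<in>{..<0}. undefined)) =
    smooth_op B 0 (\<lambda>x\<in>Rn 0. c) (\<lambda>i\<in>{..<0}. undefined)" for c
    using cinf_hom_op[OF assms Cinf_restrict[OF sm_const] e] unfolding e2 .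
  show "\<phi> \<zero>\<^bsub>ring_of A\<^esub> = \<zero>\<^bsub>ring_of B\<^esub>" unfolding ring_of_def ring_record_simps by (rule k)
  show "\<phi> \<one>\<^bsub>ring_of A\<^esub> = \<one>\<^bsub>ring_of B\<^esub>" unfolding ring_of_def monoid.simps by (rule k)
  assume "a \<in> carrier A" "b \<in> carrier A"
  then have p: "pair a b \<in> {..<2} \<rightarrow>\<^sub>E carrier A" by simp
  have k: "\<phi> (smooth_op A 2 h (pair a b)) = smooth_op B 2 h (pair (\<phi> a) (\<phi> b))" if "h \<in> Cinf 2" for h
    using cinf_hom_op[OF assms that p] unfolding pair_comp .
  have "(\<lambda>x\<in>Rn 2. x 0 + x 1) \<in> Cinf 2" "(\<lambda>x\<in>Rn 2. x 0 * x 1) \<in> Cinf 2"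
    by (rule Cinf_restrict; simp)+
  then show "\<phi> (a \<oplus>\<^bsub>ring_of A\<^esub> b) = \<phi> a \<oplus>\<^bsub>ring_of B\<^esub> \<phi> b"
    "\<phi> (a \<otimes>\<^bsub>ring_of A\<^esub> b) = \<phi> a \<otimes>\<^bsub>ring_of B\<^esub> \<phi> b"
    unfolding ring_of_def ring_record_simps monoid.simps by (simp_all only: k)
qed

lemma real_ring_of:
  "a \<oplus>\<^bsub>ring_of real_cinf_ring\<^esub> b = a + b"
  "a \<otimes>\<^bsub>ring_of real_cinf_ring\<^esub> b = a * b"
  "\<zero>\<^bsub>ring_of real_cinf_ring\<^esub> = 0"
  "\<one>\<^bsub>ring_of real_cinf_ring\<^esub> = 1"
  by (simp_all add: ring_of_def real_cinf_ring_def)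

lemmas point_ring = cinf_hom_ring[where B = real_cinf_ring, unfolded real_ring_of]

lemma pointsD: "x \<in> points A \<Longrightarrow> x \<in> cinf_hom A real_cinf_ring"
  by (simp add: points_def)

lemma point_op:
  assumes "x \<in> cinf_hom A real_cinf_ring" "f \<in> Cinf n" "a \<in> {..<n} \<rightarrow>\<^sub>E carrier A"
  shows "x (smooth_op A n f a) = f (\<lambda>i\<in>{..<n}. x (a i))"
  using cinf_hom_op[OF assms] by (simp add: real_cinf_ring_def)

context cinf_ring
begin

lemma point_ideal_ideal:
  assumes "x \<in> cinf_hom A real_cinf_ring"
  shows "ideal (point_ideal A x) R"
proof -
  note xr = point_ring[OF assms]
  have mul: "c \<otimes>\<^bsub>R\<^esub> a \<in> point_ideal A x" if a: "a \<in> point_ideal A x" and c: "c \<in> carrier A" for a c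
  proof -
    obtain d where ad: "a \<in> carrier R" "d \<in> carrier R" "x d \<noteq> 0" "a \<otimes>\<^bsub>R\<^esub> d = \<zero>\<^bsub>R\<^esub>"
      using a by (auto simp: point_ideal_def)
    have cR: "c \<in> carrier R" using c by simp
    have "(c \<otimes>\<^bsub>R\<^esub> a) \<otimes>\<^bsub>R\<^esub> d = c \<otimes>\<^bsub>R\<^esub> (a \<otimes>\<^bsub>R\<^esub> d)"
      using ad(1,2) cR by (simp only: R.m_assoc)
    then have "(c \<otimes>\<^bsub>R\<^esub> a) \<otimes>\<^bsub>R\<^esub> d = \<zero>\<^bsub>R\<^esub>" using ad(4) cR by simp
    moreover have "c \<otimes>\<^bsub>R\<^esub> a \<in> carrier R" using ad cR by (simp only: R.m_closed)
    ultimately show ?thesis using ad by (auto simp: point_ideal_def)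
  qed
  have add: "a \<oplus>\<^bsub>R\<^esub> b \<in> point_ideal A x" if a: "a \<in> point_ideal A x" and b: "b \<in> point_ideal A x" for a b
  proof -
    obtain d where ad: "a \<in> carrier R" "d \<in> carrier R" "x d \<noteq> 0" "a \<otimes>\<^bsub>R\<^esub> d = \<zero>\<^bsub>R\<^esub>"
      using a by (auto simp: point_ideal_def)
    obtain e where be: "b \<in> carrier R" "e \<in> carrier R" "x e \<noteq> 0" "b \<otimes>\<^bsub>R\<^esub> e = \<zero>\<^bsub>R\<^esub>"
      using b by (auto simp: point_ideal_def)
    have "(a \<oplus>\<^bsub>R\<^esub> b) \<otimes>\<^bsub>R\<^esub> (d \<otimes>\<^bsub>R\<^esub> e) = (a \<otimes>\<^bsub>R\<^esub> d) \<otimes>\<^bsub>R\<^esub> e \<oplus>\<^bsub>R\<^esub> (b \<otimes>\<^bsub>R\<^esub> e) \<otimes>\<^bsub>R\<^esub> d"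
      using ad(1,2) be(1,2) by algebra
    then have "(a \<oplus>\<^bsub>R\<^esub> b) \<otimes>\<^bsub>R\<^esub> (d \<otimes>\<^bsub>R\<^esub> e) = \<zero>\<^bsub>R\<^esub>"
      unfolding ad(4) be(4) R.l_null[OF be(2)] R.l_null[OF ad(2)] R.l_zero[OF R.zero_closed] .
    moreover have "x (d \<otimes>\<^bsub>R\<^esub> e) \<noteq> 0" using ad be xr(2) by simp
    moreover have "a \<oplus>\<^bsub>R\<^esub> b \<in> carrier R" "d \<otimes>\<^bsub>R\<^esub> e \<in> carrier R"
      using ad be by (simp_all only: R.a_closed R.m_closed)
    ultimately show ?thesis by (auto simp: point_ideal_def)
  qed
  have sub: "point_ideal A x \<subseteq> carrier R" by (auto simp: point_ideal_def)
  have zero: "\<zero>\<^bsub>R\<^esub> \<in> point_ideal A x"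
    using xr(4) R.zero_closed R.one_closed R.l_null[OF R.one_closed]
    by (auto simp: point_ideal_def intro!: bexI[of _ "\<one>\<^bsub>R\<^esub>"])
  have minus: "\<ominus>\<^bsub>R\<^esub> a \<in> point_ideal A x" if "a \<in> point_ideal A x" for a
  proof -
    have a: "a \<in> carrier R" using that sub by blast
    have "(\<ominus>\<^bsub>R\<^esub> \<one>\<^bsub>R\<^esub>) \<otimes>\<^bsub>R\<^esub> a \<in> point_ideal A x"
      by (rule mul[OF that]) (metis carrier_ring_of R.a_inv_closed R.one_closed)
    then show ?thesis unfolding R.l_minus[OF R.one_closed a] R.l_one[OF a] .
  qed
  show ?thesis
  proof (rule idealI)
    show "ring R" by (rule R.ring_axioms)
    show "subgroup (point_ideal A x) (add_monoid R)"
      by (rule R.add.subgroupI) (use sub zero minus add in \<open>auto simp: a_inv_def\<close>)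
    show "c \<otimes>\<^bsub>R\<^esub> a \<in> point_ideal A x" if "a \<in> point_ideal A x" "c \<in> carrier R" for a c
      using mul that by simp
    show "a \<otimes>\<^bsub>R\<^esub> c \<in> point_ideal A x" if "a \<in> point_ideal A x" "c \<in> carrier R" for a c
      using mul[OF that(1)] that sub R.m_comm[of a c] by auto
  qed
qed

context
  fixes x assumes x: "x \<in> cinf_hom A real_cinf_ring"
begin

interpretation I: ideal "point_ideal A x" R by (rule point_ideal_ideal[OF x])

lemma germ_mem_iff:
  "a \<in> carrier A \<Longrightarrow> b \<in> germ A x a \<longleftrightarrow> b \<in> carrier A \<and> b \<ominus>\<^bsub>R\<^esub> a \<in> point_ideal A x"
  unfolding germ_def
  using I.a_rcos_module_minus[OF R.ring_axioms, of a b] R.a_r_coset_subset_G[OF I.a_subset, of a]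
  by auto

lemma germ_self: "a \<in> carrier A \<Longrightarrow> a \<in> germ A x a"
  unfolding germ_def using I.a_rcos_self[of a] by simp

lemma germ_eq_of_mem: "a \<in> carrier A \<Longrightarrow> b \<in> germ A x a \<Longrightarrow> germ A x b = germ A x a"
  unfolding germ_def using I.a_repr_independence'[of b a] by simp

lemma germ_eq_iff:
  "a \<in> carrier A \<Longrightarrow> b \<in> carrier A \<Longrightarrow> germ A x b = germ A x a \<longleftrightarrow> b \<ominus>\<^bsub>R\<^esub> a \<in> point_ideal A x"
  using germ_mem_iff[of a b] germ_eq_of_mem[of a b] germ_self[of b] by blast

lemma loc_op:
  assumes f: "f \<in> Cinf n" and a: "a \<in> {..<n} \<rightarrow>\<^sub>E carrier A"
  shows "smooth_op (localization A x) n f (\<lambda>i\<in>{..<n}. germ A x (a i)) = germ A x (smooth_op A n f a)"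
proof -
  let ?P = "\<Pi>\<^sub>E i\<in>{..<n}. (\<lambda>i\<in>{..<n}. germ A x (a i)) i"
  have ai: "a i \<in> carrier A" if "i < n" for i using a that by blast
  have "a \<in> ?P" using a germ_self[OF ai] by (auto simp: PiE_def extensional_def)
  moreover have "germ A x (smooth_op A n f b) = germ A x (smooth_op A n f a)" if b: "b \<in> ?P" for b
  proof -
    have bg: "b i \<in> germ A x (a i)" if "i < n" for i
    proof -
      have "b i \<in> (\<lambda>i\<in>{..<n}. germ A x (a i)) i" using b that by (blast intro: PiE_mem)
      with that show ?thesis by simp
    qed
    have bi: "b i \<in> carrier A" "b i \<ominus>\<^bsub>R\<^esub> a i \<in> point_ideal A x" if "i < n" for i
      using bg[OF that] germ_mem_iff[OF ai[OF that]] by blast+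
    have bA: "b \<in> {..<n} \<rightarrow>\<^sub>E carrier A"
      using b bi(1) by (auto simp: PiE_def Pi_def)
    show ?thesis
      unfolding germ_eq_iff[OF op_closed[OF f a] op_closed[OF f bA]]
      by (rule ideal_op[OF I.is_ideal f a bA bi(2)])
  qed
  ultimately have "(\<Union>b\<in>?P. germ A x (smooth_op A n f b)) = germ A x (smooth_op A n f a)"
    by blast
  then show ?thesis by (simp only: localization_def cinf_ring.simps)
qed

lemma loc_tuple:
  assumes "c \<in> {..<n} \<rightarrow>\<^sub>E carrier (localization A x)"
  obtains a where "a \<in> {..<n} \<rightarrow>\<^sub>E carrier A" "c = (\<lambda>i\<in>{..<n}. germ A x (a i))"
proof -
  have "\<forall>i\<in>{..<n}. \<exists>a. a \<in> carrier A \<and> c i = germ A x a"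
  proof
    fix i assume "i \<in> {..<n}"
    then have "c i \<in> carrier (localization A x)" using assms by (blast intro: PiE_mem)
    then show "\<exists>a. a \<in> carrier A \<and> c i = germ A x a" by (auto simp: localization_def)
  qed
  then obtain a where a: "\<forall>i\<in>{..<n}. a i \<in> carrier A \<and> c i = germ A x (a i)" by metis
  have "(\<lambda>i\<in>{..<n}. a i) \<in> {..<n} \<rightarrow>\<^sub>E carrier A" using a by auto
  moreover have "c = (\<lambda>i\<in>{..<n}. germ A x ((\<lambda>i\<in>{..<n}. a i) i))"
    by (rule extensionalityI[of _ "{..<n}"]) (use a assms in \<open>auto simp: PiE_def\<close>)
  ultimately show ?thesis using that by blast
qed

lemma germ_closed: "a \<in> carrier A \<Longrightarrow> germ A x a \<in> carrier (localization A x)"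
  by (simp add: localization_def)

lemma germ_hom: "germ A x \<in> cinf_hom A (localization A x)"
  by (rule cinf_homI) (simp_all add: germ_closed loc_op)

lemma loc_cinf_ring: "cinf_ring (localization A x)"
proof
  fix n f c assume f: "f \<in> Cinf n" and "c \<in> {..<n} \<rightarrow>\<^sub>E carrier (localization A x)"
  then obtain a where a: "a \<in> {..<n} \<rightarrow>\<^sub>E carrier A" and c: "c = (\<lambda>i\<in>{..<n}. germ A x (a i))"
    using loc_tuple by metis
  show "smooth_op (localization A x) n f c \<in> carrier (localization A x)"
    unfolding c loc_op[OF f a] by (rule germ_closed[OF op_closed[OF f a]])
next
  fix n i :: nat and c assume i: "i < n" and "c \<in> {..<n} \<rightarrow>\<^sub>E carrier (localization A x)"
  then obtain a where a: "a \<in> {..<n} \<rightarrow>\<^sub>E carrier A" and c: "c = (\<lambda>i\<in>{..<n}. germ A x (a i))"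
    using loc_tuple by metis
  show "smooth_op (localization A x) n (\<lambda>x\<in>Rn n. x i) c = c i"
    unfolding c loc_op[OF Cinf_restrict[OF sm_proj[OF i]] a] op_proj[OF i a] using i by simp
next
  fix n m :: nat and h g c assume h: "h \<in> Cinf m" and g: "\<And>j. j < m \<Longrightarrow> g j \<in> Cinf n"
    and "c \<in> {..<n} \<rightarrow>\<^sub>E carrier (localization A x)"
  then obtain a where a: "a \<in> {..<n} \<rightarrow>\<^sub>E carrier A" and c: "c = (\<lambda>i\<in>{..<n}. germ A x (a i))"
    using loc_tuple by metis
  let ?b = "\<lambda>j\<in>{..<m}. smooth_op A n (g j) a"
  have b: "?b \<in> {..<m} \<rightarrow>\<^sub>E carrier A" using op_closed[OF g a] by auto
  have hg: "(\<lambda>x\<in>Rn n. h (\<lambda>j\<in>{..<m}. g j x)) \<in> Cinf n"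
    by (rule Cinf_comp[OF h g])
  have "smooth_op (localization A x) n (\<lambda>x\<in>Rn n. h (\<lambda>j\<in>{..<m}. g j x)) c = germ A x (smooth_op A m h ?b)"
  proof -
    have "smooth_op A n (\<lambda>x\<in>Rn n. h (\<lambda>j\<in>{..<m}. g j x)) a = smooth_op A m h ?b"
      by (rule op_comp[where h = h and g = g and m = m and n = n, OF h g a])
    then show ?thesis unfolding c loc_op[OF hg a] by (rule arg_cong)
  qed
  also have "\<dots> = smooth_op (localization A x) m h (\<lambda>j\<in>{..<m}. germ A x (?b j))"
    by (rule loc_op[OF h b, symmetric])
  also have "(\<lambda>j\<in>{..<m}. germ A x (?b j)) = (\<lambda>j\<in>{..<m}. smooth_op (localization A x) n (g j) c)"
    by (rule restrict_ext) (use loc_op[OF g a] c in auto)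
  finally show "smooth_op (localization A x) n (\<lambda>x\<in>Rn n. h (\<lambda>j\<in>{..<m}. g j x)) c =
     smooth_op (localization A x) m h (\<lambda>j\<in>{..<m}. smooth_op (localization A x) n (g j) c)" .
qed

end
end

definition invfun :: "real \<Rightarrow> (nat \<Rightarrow> real) \<Rightarrow> real"
  where "invfun k x = inverse (k * x 0 + 2 * (1 - k * x 0) * bump 0 (- k * x 0 + 1))"

lemma invfun_pos: "k * t + 2 * (1 - k * t) * bump 0 (- k * t + 1) > (0::real)"
proof -
  define s where "s = 1 - k * t"
  have "1 - s + 2 * s * bump 0 s > 0"
  proof (cases "s \<le> 1")
    case True
    have "s > 0 \<Longrightarrow> s * bump 0 s > 0" by (simp add: bump_def)
    moreover have "s \<le> 0 \<Longrightarrow> bump 0 s = 0" by (simp add: bump_def)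
    ultimately show ?thesis using True by (cases "s > 0") auto
  next
    case False
    then have "bump 0 s \<ge> 1 - 1 / s" using exp_ge_add_one_self[of "- (1 / s)"] by (simp add: bump_def)
    then have "s * bump 0 s \<ge> s * (1 - 1 / s)" using False by (intro mult_left_mono) auto
    moreover have "s * (1 - 1 / s) = s - 1" using False by (simp add: right_diff_distrib)
    ultimately show ?thesis using False by linarith
  qed
  then show ?thesis by (simp add: s_def algebra_simps)
qed

lemma sm_bump: "sm 1 (\<lambda>x. bump m (c * x 0 + b))"
  unfolding sm_def using Ck_bump by blast

lemma sm_invfun: "sm 1 (invfun k)"
proof -
  have "sm 1 (\<lambda>x. k * x 0 + 2 * (1 - k * x 0) * bump 0 (- k * x 0 + 1))"
    by (intro sm_add sm_mult sm_diff sm_const sm_proj sm_bump) simp_all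
  then have "Ck 1 l (\<lambda>x. inverse (k * x 0 + 2 * (1 - k * x 0) * bump 0 (- k * x 0 + 1)))" for l
    by (intro Ck_inverse) (simp_all only: sm_def invfun_pos less_imp_neq[THEN not_sym] simp_thms)
  then show ?thesis unfolding invfun_def[abs_def] sm_def by blast
qed

lemma invfun_eq: "(k * x 0 * invfun k x - 1) * bump 0 (k * x 0 + (-1)) = 0"
proof (cases "k * x 0 > 1")
  case True
  then have "bump 0 (- k * x 0 + 1) = 0" by (simp add: bump_def)
  then have "invfun k x = inverse (k * x 0)" by (simp only: invfun_def mult_zero_right add_0_right)
  moreover have "k * x 0 * inverse (k * x 0) = 1" using True by (intro right_inverse) linarith
  ultimately show ?thesis by (simp only: diff_self mult_zero_left)
next
  case False
  then show ?thesis by (simp add: bump_def)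
qed

context cinf_ring
begin

lemma op_diff:
  assumes "sm n f" "sm n g" "a \<in> {..<n} \<rightarrow>\<^sub>E carrier A"
  shows "smooth_op A n (restrict f (Rn n)) a \<ominus>\<^bsub>R\<^esub> smooth_op A n (restrict g (Rn n)) a =
    smooth_op A n (\<lambda>x\<in>Rn n. f x - g x) a"
proof -
  have "smooth_op A n (\<lambda>x\<in>Rn n. f x - g x) a \<oplus>\<^bsub>R\<^esub> smooth_op A n (restrict g (Rn n)) a =
     smooth_op A n (restrict f (Rn n)) a"
    using op_add[OF sm_diff[OF assms(1,2)] assms(2,3)] by simp
  moreover have "smooth_op A n (\<lambda>x\<in>Rn n. f x - g x) a \<in> carrier R"
    "smooth_op A n (restrict g (Rn n)) a \<in> carrier R"
    using op_closed[OF Cinf_restrict[OF sm_diff[OF assms(1,2)]] assms(3)]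
      op_closed[OF Cinf_restrict[OF assms(2)] assms(3)] by simp_all
  moreover have "(p \<oplus>\<^bsub>R\<^esub> q) \<ominus>\<^bsub>R\<^esub> q = p" if "p \<in> carrier R" "q \<in> carrier R" for p q
    using that by algebra
  ultimately show ?thesis by metis
qed

lemma germ_Units:
  assumes x: "x \<in> cinf_hom A real_cinf_ring" and a: "a \<in> carrier A" and nz: "x a \<noteq> 0"
  shows "germ A x a \<in> Units (ring_of (localization A x))"
proof -
  let ?L = "localization A x"
  interpret L: cinf_ring ?L by (rule loc_cinf_ring[OF x])
  define k where "k = 2 / x a"
  define t where "t = (\<lambda>i\<in>{..<1::nat}. a)"
  have t: "t \<in> {..<1} \<rightarrow>\<^sub>E carrier A" using a by (simp add: t_def)
  have sp: "sm 1 (\<lambda>y. y 0)" by simp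
  have at: "a = smooth_op A 1 (\<lambda>y\<in>Rn 1. y 0) t" using op_proj[OF _ t, of 0] by (simp add: t_def)
  define b where "b = smooth_op A 1 (\<lambda>y\<in>Rn 1. k * invfun k y) t"
  define d where "d = smooth_op A 1 (\<lambda>y\<in>Rn 1. bump 0 (k * y 0 + (-1))) t"
  have sb: "sm 1 (\<lambda>y. k * invfun k y)" by (intro sm_mult sm_const sm_invfun)
  have b: "b \<in> carrier A" unfolding b_def by (rule op_closed[OF Cinf_restrict[OF sb] t])
  have d: "d \<in> carrier A" unfolding d_def by (rule op_closed[OF Cinf_restrict[OF sm_bump] t])
  have sab: "sm 1 (\<lambda>y. y 0 * (k * invfun k y) - 1)" by (intro sm_diff sm_mult sp sb sm_const sm_invfun)
  have "(a \<otimes>\<^bsub>R\<^esub> b \<ominus>\<^bsub>R\<^esub> \<one>\<^bsub>R\<^esub>) \<otimes>\<^bsub>R\<^esub> d =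
     smooth_op A 1 (\<lambda>y\<in>Rn 1. (y 0 * (k * invfun k y) - 1) * bump 0 (k * y 0 + (-1))) t"
    unfolding op_one[OF t] d_def b_def
    by (subst at) (simp only: op_mult[OF sp sb t] op_diff[OF sm_mult[OF sp sb] sm_const t] op_mult[OF sab sm_bump t])
  also have "(\<lambda>y\<in>Rn 1. (y 0 * (k * invfun k y) - 1) * bump 0 (k * y 0 + (-1))) = (\<lambda>y\<in>Rn 1. 0)"
  proof (rule restrict_ext)
    fix y
    have "y 0 * (k * invfun k y) = k * y 0 * invfun k y" by simp
    then show "(y 0 * (k * invfun k y) - 1) * bump 0 (k * y 0 + (-1)) = 0"
      by (simp only: invfun_eq)
  qed
  also have "smooth_op A 1 (\<lambda>y\<in>Rn 1. 0) t = \<zero>\<^bsub>R\<^esub>" by (rule op_zero[OF t, symmetric])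
  finally have 0: "(a \<otimes>\<^bsub>R\<^esub> b \<ominus>\<^bsub>R\<^esub> \<one>\<^bsub>R\<^esub>) \<otimes>\<^bsub>R\<^esub> d = \<zero>\<^bsub>R\<^esub>" .
  have "x d = (\<lambda>y\<in>Rn 1. bump 0 (k * y 0 + (-1))) (\<lambda>i\<in>{..<1}. x (t i))"
    unfolding d_def by (rule point_op[OF x Cinf_restrict[OF sm_bump] t])
  also have "\<dots> = bump 0 (k * x a + (-1))" by (simp add: t_def)
  also have "\<dots> = bump 0 1" using nz by (simp add: k_def)
  finally have xd: "x d \<noteq> 0" by (simp add: bump_def)
  have ab: "a \<otimes>\<^bsub>R\<^esub> b \<in> carrier A" "\<one>\<^bsub>R\<^esub> \<in> carrier A" using ring_of_closed a b by blast+
  have "a \<otimes>\<^bsub>R\<^esub> b \<ominus>\<^bsub>R\<^esub> \<one>\<^bsub>R\<^esub> \<in> carrier R"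
    by (rule R.minus_closed) (use ab in simp_all)
  then have "a \<otimes>\<^bsub>R\<^esub> b \<ominus>\<^bsub>R\<^esub> \<one>\<^bsub>R\<^esub> \<in> point_ideal A x"
    using 0 xd d by (auto simp: point_ideal_def)
  then have "germ A x (a \<otimes>\<^bsub>R\<^esub> b) = germ A x \<one>\<^bsub>R\<^esub>"
    using germ_eq_iff[OF x ab(2,1)] by blast
  then have e: "germ A x a \<otimes>\<^bsub>ring_of ?L\<^esub> germ A x b = \<one>\<^bsub>ring_of ?L\<^esub>"
    unfolding cinf_hom_ring(2)[OF germ_hom[OF x] a b] cinf_hom_ring(4)[OF germ_hom[OF x]] .
  moreover have ga: "germ A x a \<in> carrier (ring_of ?L)" "germ A x b \<in> carrier (ring_of ?L)"
    using germ_closed[OF x] a b by simp_all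
  moreover have "germ A x b \<otimes>\<^bsub>ring_of ?L\<^esub> germ A x a = \<one>\<^bsub>ring_of ?L\<^esub>"
    using L.R.m_comm[OF ga] e by simp
  ultimately show ?thesis unfolding Units_def by blast
qed

lemma hom_germ_eq:
  assumes x: "x \<in> cinf_hom A real_cinf_ring" and C: "cinf_ring C" and \<psi>: "\<psi> \<in> cinf_hom A C"
    and u: "\<And>a. a \<in> carrier A \<Longrightarrow> x a \<noteq> 0 \<Longrightarrow> \<psi> a \<in> Units (ring_of C)"
    and a: "a \<in> carrier A" and b: "b \<in> carrier A" and e: "germ A x a = germ A x b"
  shows "\<psi> a = \<psi> b"
proof -
  interpret C: cinf_ring C by (rule C)
  let ?e = "a \<ominus>\<^bsub>R\<^esub> b"
  have "?e \<in> point_ideal A x" using e germ_eq_iff[OF x b a] by blast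
  then obtain d where eA: "?e \<in> carrier A" and d: "d \<in> carrier A" "x d \<noteq> 0" "?e \<otimes>\<^bsub>R\<^esub> d = \<zero>\<^bsub>R\<^esub>"
    by (auto simp: point_ideal_def)
  have z: "\<psi> ?e \<otimes>\<^bsub>ring_of C\<^esub> \<psi> d = \<zero>\<^bsub>ring_of C\<^esub>"
    unfolding cinf_hom_ring(2)[OF \<psi> eA d(1), symmetric] d(3) by (rule cinf_hom_ring(3)[OF \<psi>])
  have ud: "\<psi> d \<in> Units (ring_of C)" by (rule u[OF d(1,2)])
  have c: "\<psi> ?e \<in> carrier (ring_of C)" "\<psi> b \<in> carrier (ring_of C)" "\<psi> d \<in> carrier (ring_of C)"
    using cinf_hom_closed[OF \<psi>] eA b d by simp_all
  obtain w where w: "w \<in> carrier (ring_of C)" "\<psi> d \<otimes>\<^bsub>ring_of C\<^esub> w = \<one>\<^bsub>ring_of C\<^esub>"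
    using ud unfolding Units_def by blast
  have "\<psi> ?e = (\<psi> ?e \<otimes>\<^bsub>ring_of C\<^esub> \<psi> d) \<otimes>\<^bsub>ring_of C\<^esub> w"
    unfolding C.R.m_assoc[OF c(1) c(3) w(1)] w(2) C.R.r_one[OF c(1)] ..
  then have pe: "\<psi> ?e = \<zero>\<^bsub>ring_of C\<^esub>" unfolding z C.R.l_null[OF w(1)] .
  have "?e \<oplus>\<^bsub>R\<^esub> b = a" using a b unfolding carrier_ring_of[symmetric, of A] by algebra
  then have "\<psi> a = \<psi> ?e \<oplus>\<^bsub>ring_of C\<^esub> \<psi> b" using cinf_hom_ring(1)[OF \<psi> eA b] by simp
  then show ?thesis unfolding pe C.R.l_zero[OF c(2)] .
qed

theorem localization_universal:
  assumes x: "x \<in> cinf_hom A real_cinf_ring" and C: "cinf_ring C" and \<psi>: "\<psi> \<in> cinf_hom A C"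
    and u: "\<And>a. a \<in> carrier A \<Longrightarrow> x a \<noteq> 0 \<Longrightarrow> \<psi> a \<in> Units (ring_of C)"
  shows "\<exists>!\<theta>. \<theta> \<in> cinf_hom (localization A x) C \<and> \<theta> \<in> extensional (carrier (localization A x)) \<and>
    (\<forall>a\<in>carrier A. \<theta> (germ A x a) = \<psi> a)"
proof (rule ex_ex1I)
  let ?L = "localization A x"
  let ?\<theta> = "\<lambda>c\<in>carrier ?L. \<psi> (SOME a. a \<in> carrier A \<and> germ A x a = c)"
  have eq: "?\<theta> (germ A x a) = \<psi> a" if a: "a \<in> carrier A" for a
  proof -
    let ?P = "\<lambda>a'. a' \<in> carrier A \<and> germ A x a' = germ A x a"
    have "?P (SOME a'. ?P a')" using someI[of ?P a] a by blast
    then have "\<psi> (SOME a'. ?P a') = \<psi> a" using hom_germ_eq[OF x C \<psi> u] a by blast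
    then show ?thesis using germ_closed[OF x a] by simp
  qed
  have "?\<theta> \<in> cinf_hom ?L C"
  proof (rule cinf_homI)
    fix c assume "c \<in> carrier ?L"
    then obtain a where a: "a \<in> carrier A" "c = germ A x a" by (auto simp: localization_def)
    show "?\<theta> c \<in> carrier C" unfolding a(2) eq[OF a(1)] by (rule cinf_hom_closed[OF \<psi> a(1)])
  next
    fix n f c assume f: "f \<in> Cinf n" and "c \<in> {..<n} \<rightarrow>\<^sub>E carrier ?L"
    then obtain a where a: "a \<in> {..<n} \<rightarrow>\<^sub>E carrier A" and c: "c = (\<lambda>i\<in>{..<n}. germ A x (a i))"
      using loc_tuple[OF x] by metis
    have "?\<theta> (smooth_op ?L n f c) = \<psi> (smooth_op A n f a)"
      unfolding c loc_op[OF x f a] by (rule eq[OF op_closed[OF f a]])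
    also have "\<dots> = smooth_op C n f (\<lambda>i\<in>{..<n}. \<psi> (a i))" by (rule cinf_hom_op[OF \<psi> f a])
    also have "(\<lambda>i\<in>{..<n}. \<psi> (a i)) = (\<lambda>i\<in>{..<n}. ?\<theta> (c i))"
    proof (rule restrict_ext)
      fix i assume i: "i \<in> {..<n}"
      then have "a i \<in> carrier A" using a by blast
      then show "\<psi> (a i) = ?\<theta> (c i)" unfolding c using i eq by simp
    qed
    finally show "?\<theta> (smooth_op ?L n f c) = smooth_op C n f (\<lambda>i\<in>{..<n}. ?\<theta> (c i))" .
  qed
  moreover have "?\<theta> \<in> extensional (carrier ?L)" by (rule restrict_extensional)
  ultimately show "\<exists>\<theta>. \<theta> \<in> cinf_hom ?L C \<and> \<theta> \<in> extensional (carrier ?L) \<and>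
    (\<forall>a\<in>carrier A. \<theta> (germ A x a) = \<psi> a)" using eq by blast
next
  fix \<theta> \<theta>' assume 1: "\<theta> \<in> cinf_hom (localization A x) C \<and> \<theta> \<in> extensional (carrier (localization A x)) \<and>
    (\<forall>a\<in>carrier A. \<theta> (germ A x a) = \<psi> a)"
    and 2: "\<theta>' \<in> cinf_hom (localization A x) C \<and> \<theta>' \<in> extensional (carrier (localization A x)) \<and>
    (\<forall>a\<in>carrier A. \<theta>' (germ A x a) = \<psi> a)"
  show "\<theta> = \<theta>'"
  proof (rule extensionalityI)
    show "\<theta> \<in> extensional (carrier (localization A x))" "\<theta>' \<in> extensional (carrier (localization A x))"
      using 1 2 by blast+
    fix c assume "c \<in> carrier (localization A x)"
    then obtain a where "a \<in> carrier A" "c = germ A x a" by (auto simp: localization_def)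
    then show "\<theta> c = \<theta>' c" using 1 2 by simp
  qed
qed

end

context poisson_cinf_ring
begin

lemma bracket_zero:
  assumes c: "c \<in> carrier A" shows "bracket A \<zero>\<^bsub>ring_of A\<^esub> c = \<zero>\<^bsub>ring_of A\<^esub>" "bracket A c \<zero>\<^bsub>ring_of A\<^esub> = \<zero>\<^bsub>ring_of A\<^esub>"
proof -
  have z: "\<zero>\<^bsub>R\<^esub> \<in> carrier A" using ring_of_closed by blast
  have b: "bracket A \<zero>\<^bsub>R\<^esub> c \<in> carrier R" using bracket_closed[OF z c] by simp
  have "bracket A \<zero>\<^bsub>R\<^esub> c = bracket A \<zero>\<^bsub>R\<^esub> c \<oplus>\<^bsub>R\<^esub> bracket A \<zero>\<^bsub>R\<^esub> c"
    using bracket_add[OF z z c] unfolding R.l_zero[OF R.zero_closed] .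
  then show 1: "bracket A \<zero>\<^bsub>R\<^esub> c = \<zero>\<^bsub>R\<^esub>"
    using R.add.l_cancel_one'[OF b b] by simp
  show "bracket A c \<zero>\<^bsub>R\<^esub> = \<zero>\<^bsub>R\<^esub>"
    unfolding bracket_skew[OF c z] 1 by (rule R.minus_zero)
qed

lemma bracket_minus_left:
  assumes "a \<in> carrier A" "b \<in> carrier A" "c \<in> carrier A"
  shows "bracket A (a \<ominus>\<^bsub>R\<^esub> b) c = bracket A a c \<ominus>\<^bsub>R\<^esub> bracket A b c"
proof -
  have R: "a \<in> carrier R" "b \<in> carrier R" using assms by simp_all
  have m: "a \<ominus>\<^bsub>R\<^esub> b \<in> carrier A" using R.minus_closed[OF R] by simp
  have "(a \<ominus>\<^bsub>R\<^esub> b) \<oplus>\<^bsub>R\<^esub> b = a" using R by algebra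
  then have e: "bracket A (a \<ominus>\<^bsub>R\<^esub> b) c \<oplus>\<^bsub>R\<^esub> bracket A b c = bracket A a c"
    using bracket_add[OF m assms(2,3)] by simp
  have "(p \<oplus>\<^bsub>R\<^esub> q) \<ominus>\<^bsub>R\<^esub> q = p" if "p \<in> carrier R" "q \<in> carrier R" for p q
    using that by algebra
  from this[of "bracket A (a \<ominus>\<^bsub>R\<^esub> b) c" "bracket A b c"] show ?thesis
    unfolding e using bracket_closed assms m by simp
qed

lemma bracket_minus_right:
  assumes "a \<in> carrier A" "b \<in> carrier A" "c \<in> carrier A"
  shows "bracket A c (a \<ominus>\<^bsub>R\<^esub> b) = bracket A c a \<ominus>\<^bsub>R\<^esub> bracket A c b"
proof -
  have m: "a \<ominus>\<^bsub>R\<^esub> b \<in> carrier A" using R.minus_closed[of a b] assms by simp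
  have "\<ominus>\<^bsub>R\<^esub> (p \<ominus>\<^bsub>R\<^esub> q) = (\<ominus>\<^bsub>R\<^esub> p) \<ominus>\<^bsub>R\<^esub> (\<ominus>\<^bsub>R\<^esub> q)" if "p \<in> carrier R" "q \<in> carrier R" for p q
    using that by algebra
  from this[of "bracket A a c" "bracket A b c"] show ?thesis
    unfolding bracket_skew[OF assms(3) m] bracket_skew[OF assms(3) assms(1)] bracket_skew[OF assms(3) assms(2)]
      bracket_minus_left[OF assms]
    using bracket_closed assms by simp
qed

lemma point_ideal_poisson:
  assumes x: "x \<in> cinf_hom A real_cinf_ring" and a: "a \<in> point_ideal A x" and c: "c \<in> carrier A"
  shows "bracket A c a \<in> point_ideal A x" "bracket A a c \<in> point_ideal A x"
proof -
  interpret I: ideal "point_ideal A x" R by (rule point_ideal_ideal[OF x])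
  obtain d where aA: "a \<in> carrier A" and d: "d \<in> carrier A" "x d \<noteq> 0" "a \<otimes>\<^bsub>R\<^esub> d = \<zero>\<^bsub>R\<^esub>"
    using a by (auto simp: point_ideal_def)
  let ?p = "bracket A c a" and ?q = "bracket A c d"
  have z: "?p \<otimes>\<^bsub>R\<^esub> d \<oplus>\<^bsub>R\<^esub> a \<otimes>\<^bsub>R\<^esub> ?q = \<zero>\<^bsub>R\<^esub>"
    unfolding bracket_leibniz[OF c aA d(1), symmetric] d(3) by (rule bracket_zero(2)[OF c])
  have R: "?p \<in> carrier R" "?q \<in> carrier R" "a \<in> carrier R" "d \<in> carrier R"
    using bracket_closed aA d c by simp_all
  have "?p \<otimes>\<^bsub>R\<^esub> (d \<otimes>\<^bsub>R\<^esub> d) = (?p \<otimes>\<^bsub>R\<^esub> d \<oplus>\<^bsub>R\<^esub> a \<otimes>\<^bsub>R\<^esub> ?q) \<otimes>\<^bsub>R\<^esub> d \<ominus>\<^bsub>R\<^esub> (a \<otimes>\<^bsub>R\<^esub> d) \<otimes>\<^bsub>R\<^esub> ?q"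
    using R by algebra
  also have "\<dots> = \<zero>\<^bsub>R\<^esub>"
    unfolding z d(3) R.l_null[OF R(4)] R.l_null[OF R(2)] using R.r_neg[OF R.zero_closed] by (simp only: R.minus_eq)
  finally have "?p \<otimes>\<^bsub>R\<^esub> (d \<otimes>\<^bsub>R\<^esub> d) = \<zero>\<^bsub>R\<^esub>" .
  moreover have "x (d \<otimes>\<^bsub>R\<^esub> d) \<noteq> 0" using point_ring(2)[OF x d(1) d(1)] d(2) by simp
  moreover have "d \<otimes>\<^bsub>R\<^esub> d \<in> carrier A" by (rule ring_of_closed(2)[OF d(1) d(1)])
  ultimately show 1: "?p \<in> point_ideal A x" using R(1) by (auto simp: point_ideal_def)
  show "bracket A a c \<in> point_ideal A x"
    unfolding bracket_skew[OF aA c] by (rule I.a_inv_closed[OF 1])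
qed

lemma loc_bracket:
  assumes x: "x \<in> cinf_hom A real_cinf_ring" and a: "a \<in> carrier A" and b: "b \<in> carrier A"
  shows "bracket (poisson_localization A x) (germ A x a) (germ A x b) = germ A x (bracket A a b)"
proof -
  interpret I: ideal "point_ideal A x" R by (rule point_ideal_ideal[OF x])
  have "germ A x (bracket A a' b') = germ A x (bracket A a b)"
    if a': "a' \<in> germ A x a" and b': "b' \<in> germ A x b" for a' b'
  proof -
    have A: "a' \<in> carrier A" "a' \<ominus>\<^bsub>R\<^esub> a \<in> point_ideal A x" "b' \<in> carrier A" "b' \<ominus>\<^bsub>R\<^esub> b \<in> point_ideal A x"
      using a' b' germ_mem_iff[OF x a] germ_mem_iff[OF x b] by blast+
    have 1: "bracket A a' b' \<ominus>\<^bsub>R\<^esub> bracket A a b' \<in> point_ideal A x"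
      using point_ideal_poisson(2)[OF x A(2) A(3)] unfolding bracket_minus_left[OF A(1) a A(3)] .
    have 2: "bracket A a b' \<ominus>\<^bsub>R\<^esub> bracket A a b \<in> point_ideal A x"
      using point_ideal_poisson(1)[OF x A(4) a] unfolding bracket_minus_right[OF A(3) b a] .
    show ?thesis
      using 1 2 germ_eq_iff[OF x] bracket_closed A(1,3) a b by metis
  qed
  then have "(\<Union>a'\<in>germ A x a. \<Union>b'\<in>germ A x b. germ A x (bracket A a' b')) = germ A x (bracket A a b)"
    using germ_self[OF x a] germ_self[OF x b] by blast
  then show ?thesis by (simp only: poisson_localization_def poisson_cinf_ring.simps)
qed

end

context cinf_ring
begin

lemma openin_spec_top:
  "openin (spec_top A) = arbitrary union_of (\<lambda>U. \<exists>a\<in>carrier A. U = {x \<in> points A. x a \<noteq> 0})"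
  unfolding spec_top_def
proof (rule topology_inverse', rule istopology_base)
  fix S T assume "\<exists>a\<in>carrier A. S = {x \<in> points A. x a \<noteq> 0}" "\<exists>a\<in>carrier A. T = {x \<in> points A. x a \<noteq> 0}"
  then obtain a b where ab: "a \<in> carrier A" "b \<in> carrier A"
    "S = {x \<in> points A. x a \<noteq> 0}" "T = {x \<in> points A. x b \<noteq> 0}" by blast
  have "S \<inter> T = {x \<in> points A. x (a \<otimes>\<^bsub>R\<^esub> b) \<noteq> 0}"
  proof -
    have "x (a \<otimes>\<^bsub>R\<^esub> b) = x a * x b" if "x \<in> points A" for x
      by (rule point_ring(2)[OF pointsD[OF that] ab(1,2)])
    then show ?thesis unfolding ab(3,4) by fastforce
  qed
  then show "\<exists>a\<in>carrier A. S \<inter> T = {x \<in> points A. x a \<noteq> 0}"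
    using ring_of_closed(2)[OF ab(1,2)] by blast
qed

lemma openin_spec_sub: "openin (spec_top A) U \<Longrightarrow> U \<subseteq> points A"
  unfolding openin_spec_top union_of_def by blast

lemma topspace_spec [simp]: "topspace (spec_top A) = points A"
proof
  show "topspace (spec_top A) \<subseteq> points A" using openin_spec_sub by blast
  have "points A = {x \<in> points A. x \<one>\<^bsub>R\<^esub> \<noteq> 0}" 
  proof -
    have "x \<one>\<^bsub>R\<^esub> = 1" if "x \<in> points A" for x by (rule point_ring(4)[OF pointsD[OF that]])
    then show ?thesis by fastforce
  qed
  then have "openin (spec_top A) (points A)"
    unfolding openin_spec_top using ring_of_closed(4)
    by (intro arbitrary_union_of_inc) blast
  then show "points A \<subseteq> topspace (spec_top A)" by (rule openin_subset)
qed

end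

lemma spec_fun_points:
  assumes A: "cinf_ring A" and \<phi>: "\<phi> \<in> cinf_hom A B" and x: "x \<in> points B"
  shows "spec_fun A B \<phi> x \<in> points A"
    and "a \<in> carrier A \<Longrightarrow> spec_fun A B \<phi> x a = x (\<phi> a)"
proof -
  have e: "spec_fun A B \<phi> x = restrict (\<lambda>a. x (\<phi> a)) (carrier A)"
    using x by (simp add: spec_fun_def compose_def)
  show "a \<in> carrier A \<Longrightarrow> spec_fun A B \<phi> x a = x (\<phi> a)" unfolding e by simp
  have "spec_fun A B \<phi> x \<in> cinf_hom A real_cinf_ring"
    by (rule cinf_hom_restrict[OF A cinf_hom_comp[OF \<phi> pointsD[OF x]]]) (simp add: e)
  then show "spec_fun A B \<phi> x \<in> points A" unfolding points_def e by simp
qed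

lemma localization_map_ex1:
  fixes A :: "('a, 'm) cinf_ring_scheme" and B :: "('b, 'k) cinf_ring_scheme"
  assumes A: "cinf_ring A" and B: "cinf_ring B" and \<phi>: "\<phi> \<in> cinf_hom A B" and x: "x \<in> points B"
  defines "y \<equiv> spec_fun A B \<phi> x"
  shows "\<exists>!\<psi>. \<psi> \<in> cinf_hom (localization A y) (localization B x) \<and>
    \<psi> \<in> extensional (carrier (localization A y)) \<and>
    (\<forall>a\<in>carrier A. \<psi> (germ A y a) = germ B x (\<phi> a))"
proof -
  interpret A: cinf_ring A by (rule A)
  interpret B: cinf_ring B by (rule B)
  have y: "y \<in> cinf_hom A real_cinf_ring" unfolding y_def by (rule pointsD[OF spec_fun_points(1)[OF A \<phi> x]])
  show ?thesis
  proof (rule A.localization_universal[OF y B.loc_cinf_ring[OF pointsD[OF x]]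
        cinf_hom_comp[OF \<phi> B.germ_hom[OF pointsD[OF x]]]])
    fix a assume a: "a \<in> carrier A" "y a \<noteq> 0"
    show "germ B x (\<phi> a) \<in> Units (ring_of (localization B x))"
      by (rule B.germ_Units[OF pointsD[OF x] cinf_hom_closed[OF \<phi> a(1)]])
        (use a spec_fun_points(2)[OF A \<phi> x a(1)] y_def in simp)
  qed
qed

lemma localization_map_props:
  fixes A :: "('a, 'm) cinf_ring_scheme" and B :: "('b, 'k) cinf_ring_scheme"
  assumes "cinf_ring A" and "cinf_ring B" and "\<phi> \<in> cinf_hom A B" and "x \<in> points B"
  defines "y \<equiv> spec_fun A B \<phi> x"
  shows "localization_map A B \<phi> x \<in> cinf_hom (localization A y) (localization B x)"
    and "a \<in> carrier A \<Longrightarrow> localization_map A B \<phi> x (germ A y a) = germ B x (\<phi> a)"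
  using theI'[OF localization_map_ex1[OF assms(1-4)]]
  unfolding localization_map_def Let_def y_def by blast+

lemma poisson_sheaf_bracket:
  assumes "poisson_cinf_ring A" "openin (spec_top A) U" "a \<in> carrier A" "b \<in> carrier A"
  shows "bracket (poisson_sheaf A U) (global_section A U a) (global_section A U b) =
    global_section A U (bracket A a b)"
proof -
  interpret poisson_cinf_ring A by fact
  have "bracket (poisson_localization A x) (germ A x a) (germ A x b) = germ A x (bracket A a b)" if "x \<in> U" for x
    using loc_bracket[OF pointsD _ _] openin_spec_sub[OF assms(2)] that assms by blast
  then show ?thesis by (auto simp: poisson_sheaf_def global_section_def intro!: restrict_ext)
qed

lemma sheaf_map_section:
  assumes "cinf_ring A" "cinf_ring B" "\<phi> \<in> cinf_hom A B" "openin (spec_top A) U" "a \<in> carrier A"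
  shows "sheaf_map A B \<phi> U (global_section A U a) =
    global_section B (spec_preimage A B \<phi> U) (\<phi> a)"
  using localization_map_props(2)[OF assms(1-3) _ assms(5)]
  by (auto simp: sheaf_map_def global_section_def spec_preimage_def intro!: restrict_ext)

lemma spec_preimage_open:
  assumes A: "cinf_ring A" and B: "cinf_ring B" and \<phi>: "\<phi> \<in> cinf_hom A B" and U: "openin (spec_top A) U"
  shows "openin (spec_top B) (spec_preimage A B \<phi> U)"
proof -
  obtain \<U> where \<U>: "\<And>W. W \<in> \<U> \<Longrightarrow> \<exists>a\<in>carrier A. W = {x \<in> points A. x a \<noteq> 0}" "\<Union>\<U> = U"
    using U unfolding cinf_ring.openin_spec_top[OF A] union_of_def by blast
  have "openin (spec_top B) (spec_preimage A B \<phi> W)" if W: "W \<in> \<U>" for W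
  proof -
    obtain a where a: "a \<in> carrier A" "W = {x \<in> points A. x a \<noteq> 0}" using \<U>(1)[OF W] by blast
    have "spec_preimage A B \<phi> W = {x \<in> points B. x (\<phi> a) \<noteq> 0}"
      unfolding spec_preimage_def a(2)
      using spec_fun_points(1)[OF A \<phi>] spec_fun_points(2)[OF A \<phi> _ a(1)] by auto
    then show ?thesis
      unfolding cinf_ring.openin_spec_top[OF B] using cinf_hom_closed[OF \<phi> a(1)]
      by (intro arbitrary_union_of_inc) blast
  qed
  moreover have "spec_preimage A B \<phi> U = \<Union> (spec_preimage A B \<phi> ` \<U>)"
    unfolding \<U>(2)[symmetric] spec_preimage_def by blast
  ultimately show ?thesis by (metis (no_types, lifting) imageE openin_Union)
qed

end

theory Submission
  imports Defs
begin

text \<open>The bracket of sections is computed point by point in the localizations, and so is the map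
  induced on sections.  Preservation of brackets is therefore a statement about a single point \<open>x\<close> of
  the spectrum of \<open>B\<close>: the map of localizations at \<open>x\<close> preserves brackets, which it inherits from
  \<open>\<phi>\<close> (lemma \<open>localization_map_bracket\<close>).  Only the fact that sections are mapped to sections is
  local rather than pointwise; it rests on the continuity of the map of spectra
  (lemma \<open>sheaf_map_closed\<close>).\<close>

text \<open>Every element of a localization is a germ, so it suffices to compare the two sides on germs of
  \<open>a\<close> and \<open>b\<close>.  There the bracket is the germ of \<open>{a, b}\<close> and the map is \<open>\<phi>\<close> on representatives.\<close>

lemma localization_map_bracket:
  fixes A :: "('a, 'm) poisson_cinf_ring_scheme" and B :: "('b, 'k) poisson_cinf_ring_scheme"
  assumes A: "poisson_cinf_ring A" and B: "poisson_cinf_ring B" and \<phi>: "\<phi> \<in> poisson_hom A B"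
    and x: "x \<in> points B"
  defines "y \<equiv> spec_fun A B \<phi> x"
  assumes c: "c \<in> carrier (localization A y)" and d: "d \<in> carrier (localization A y)"
  shows "localization_map A B \<phi> x (bracket (poisson_localization A y) c d) =
    bracket (poisson_localization B x) (localization_map A B \<phi> x c) (localization_map A B \<phi> x d)"
proof -
  interpret A: poisson_cinf_ring A by (rule A)
  interpret B: poisson_cinf_ring B by (rule B)
  have hom: "\<phi> \<in> cinf_hom A B" using \<phi> by (simp add: poisson_hom_def)
  have y: "y \<in> cinf_hom A real_cinf_ring"
    unfolding y_def by (rule pointsD[OF spec_fun_points(1)[OF A.cinf_ring_axioms hom x]])
  obtain a b where ab: "a \<in> carrier A" "b \<in> carrier A"
    and c_eq: "c = germ A y a" and d_eq: "d = germ A y b"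
    using c d by (auto simp: localization_def)
  have on_germ: "localization_map A B \<phi> x (germ A y e) = germ B x (\<phi> e)" if "e \<in> carrier A" for e
    unfolding y_def
    by (rule localization_map_props(2)[OF A.cinf_ring_axioms B.cinf_ring_axioms hom x that])
  have "localization_map A B \<phi> x (bracket (poisson_localization A y) c d)
      = germ B x (\<phi> (bracket A a b))"
    unfolding c_eq d_eq A.loc_bracket[OF y ab] by (rule on_germ[OF A.bracket_closed[OF ab]])
  also have "\<dots> = germ B x (bracket B (\<phi> a) (\<phi> b))"
    using \<phi> ab by (simp add: poisson_hom_def)
  also have "\<dots> = bracket (poisson_localization B x) (germ B x (\<phi> a)) (germ B x (\<phi> b))"
    by (rule B.loc_bracket[OF pointsD[OF x] cinf_hom_closed[OF hom ab(1)]
          cinf_hom_closed[OF hom ab(2)], symmetric])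
  finally show ?thesis unfolding c_eq d_eq on_germ[OF ab(1)] on_germ[OF ab(2)] .
qed

text \<open>Where a section is the germ of \<open>a\<close> on an open set \<open>V\<close>, its image is the germ of \<open>\<phi> a\<close> on the
  preimage of \<open>V\<close>, and these preimages form an open cover of the preimage of \<open>U\<close>.\<close>

lemma sheaf_map_closed:
  fixes A :: "('a, 'm) cinf_ring_scheme" and B :: "('b, 'k) cinf_ring_scheme"
  assumes A: "cinf_ring A" and B: "cinf_ring B" and \<phi>: "\<phi> \<in> cinf_hom A B"
    and s: "s \<in> carrier (structure_sheaf A U)"
  shows "sheaf_map A B \<phi> U s \<in> carrier (structure_sheaf B (spec_preimage A B \<phi> U))"
proof -
  have loc: "\<exists>W b. openin (spec_top B) W \<and> x \<in> W \<and> W \<subseteq> spec_preimage A B \<phi> U \<and>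
      b \<in> carrier B \<and> (\<forall>z\<in>W. sheaf_map A B \<phi> U s z = germ B z b)"
    if x: "x \<in> spec_preimage A B \<phi> U" for x
  proof -
    have xB: "x \<in> points B" and "spec_fun A B \<phi> x \<in> U"
      using x by (auto simp: spec_preimage_def)
    then obtain V a where V: "openin (spec_top A) V" "spec_fun A B \<phi> x \<in> V" "V \<subseteq> U"
      and a: "a \<in> carrier A" and s_eq: "\<And>y. y \<in> V \<Longrightarrow> s y = germ A y a"
      using s unfolding structure_sheaf_def by auto
    let ?W = "spec_preimage A B \<phi> V"
    have W: "?W \<subseteq> spec_preimage A B \<phi> U" using V(3) by (auto simp: spec_preimage_def)
    have "sheaf_map A B \<phi> U s z = germ B z (\<phi> a)" if z: "z \<in> ?W" for z
    proof -
      have "z \<in> points B" "spec_fun A B \<phi> z \<in> V" using z by (auto simp: spec_preimage_def)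
      then show ?thesis
        using W z localization_map_props(2)[OF A B \<phi> _ a] s_eq by (auto simp: sheaf_map_def)
    qed
    moreover have "x \<in> ?W" using xB V(2) by (simp add: spec_preimage_def)
    ultimately show ?thesis
      using spec_preimage_open[OF A B \<phi> V(1)] W cinf_hom_closed[OF \<phi> a] by blast
  qed
  moreover have "sheaf_map A B \<phi> U s \<in>
      (\<Pi>\<^sub>E x\<in>spec_preimage A B \<phi> U. carrier (localization B x))"
  proof (rule PiE_I)
    fix x assume "x \<in> spec_preimage A B \<phi> U"
    then obtain b where "b \<in> carrier B" "sheaf_map A B \<phi> U s x = germ B x b"
      using loc by blast
    then show "sheaf_map A B \<phi> U s x \<in> carrier (localization B x)"
      by (simp add: localization_def)
  qed (simp add: sheaf_map_def)
  ultimately show ?thesis by (simp add: structure_sheaf_def)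
qed

theorem lemma3p23:
  fixes A :: "'a poisson_cinf_ring" and B :: "'b poisson_cinf_ring" and \<phi> :: "'a \<Rightarrow> 'b"
  assumes "poisson_cinf_ring A" and "poisson_cinf_ring B"
    and "\<phi> \<in> poisson_hom A B"
  shows "\<forall>U. openin (spec_top A) U \<longrightarrow>
    sheaf_map A B \<phi> U \<in>
      carrier (poisson_sheaf A U) \<rightarrow> carrier (poisson_sheaf B (spec_preimage A B \<phi> U)) \<and>
    (\<forall>s\<in>carrier (poisson_sheaf A U). \<forall>t\<in>carrier (poisson_sheaf A U).
       sheaf_map A B \<phi> U (bracket (poisson_sheaf A U) s t) =
       bracket (poisson_sheaf B (spec_preimage A B \<phi> U))
         (sheaf_map A B \<phi> U s) (sheaf_map A B \<phi> U t))"
proof (intro allI impI conjI ballI)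
  fix U
  interpret A: poisson_cinf_ring A by (rule assms(1))
  interpret B: poisson_cinf_ring B by (rule assms(2))
  have hom: "\<phi> \<in> cinf_hom A B" using assms(3) by (simp add: poisson_hom_def)
  show "sheaf_map A B \<phi> U \<in>
      carrier (poisson_sheaf A U) \<rightarrow> carrier (poisson_sheaf B (spec_preimage A B \<phi> U))"
    using sheaf_map_closed[OF A.cinf_ring_axioms B.cinf_ring_axioms hom]
    by (simp add: poisson_sheaf_def)
  fix s t
  assume s: "s \<in> carrier (poisson_sheaf A U)" and t: "t \<in> carrier (poisson_sheaf A U)"
  have stalk: "r y \<in> carrier (localization A y)" if "r \<in> carrier (poisson_sheaf A U)" "y \<in> U" for r y
    using that by (auto simp: poisson_sheaf_def structure_sheaf_def)
  show "sheaf_map A B \<phi> U (bracket (poisson_sheaf A U) s t) =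
       bracket (poisson_sheaf B (spec_preimage A B \<phi> U))
         (sheaf_map A B \<phi> U s) (sheaf_map A B \<phi> U t)" (is "?L = ?R")
  proof (rule extensionalityI)
    show "?L \<in> extensional (spec_preimage A B \<phi> U)" by (simp add: sheaf_map_def)
    show "?R \<in> extensional (spec_preimage A B \<phi> U)" by (simp add: poisson_sheaf_def)
  next
    fix x assume x: "x \<in> spec_preimage A B \<phi> U"
    then have xB: "x \<in> points B" and y: "spec_fun A B \<phi> x \<in> U" by (auto simp: spec_preimage_def)
    show "?L x = ?R x"
      using localization_map_bracket[OF assms xB stalk[OF s y] stalk[OF t y]] x y
      by (simp add: sheaf_map_def poisson_sheaf_def)
  qed
qed

end
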